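(* Let $V$ be a set of $n$ items, let $T$ be the time horizon, let $s_1,\dots,s_T : V\to\{0,1\}$ be the feedback observed in steps $1,\dots,T$, and let $M>0$ be (an upper bound on) $\max_{t=1,\dots,T}\sum_{\{u,v\}\subseteq V}(s_t(v)-s_t(u))^2$. Assume that $T$ is at least $n^2M^{-1}\log 2$. If $\mathrm{OnlineRank}$ is run with either $\mathrm{SortProc}=\mathrm{QuickSort}$ or $\mathrm{SortProc}=\mathrm{PlackettLuce}$ and with learning rate $\eta = n\sqrt{\log 2}/\sqrt{TM}\le 1$, then $$\mathbb{E}[L_T(\mathrm{OnlineRank})] \le L_T(\pi^* ) + n\sqrt{TM\log 2}.$$ Additionally, the running time per step is $O(n\log n)$.
   Context: $\log$ is the natural logarithm. A ranking of $V$ is an injection (hence bijection) $\pi:V\to[n]=\{1,\dots,n\}$; $S(V)$ is the set of rankings; $\pi(v)$ is the position of $v$. Write $u\prec_\pi v$ if $\pi(u)<\pi(v)$, and $[u,v]_\pi\in\{0,1\}$ for the indicator of $u\prec_\pi v$. Let $[x]_+=\max(x,0)$. Sums over $\{u,v\}\subseteq V$ range over unordered pairs of distinct elements. Game: at each step $t=1,\dots,T$ the algorithm outputs a (randomized) ranking $\pi_t\in S(V)$ and then observes $s_t:V\to\{0,1\}$, the indicator function of a subset $U_t\subseteq V$ of chosen items (adversarial feedback). The pairwise loss is $$\ell\ell(\pi,s)=\sum_{u\ne v}[u,v]_\pi\,[s(v)-s(u)]_+ ,$$ summed over ordered pairs of distinct elements of $V$. For each $s$ it differs from $\sum_{u\in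 V}\pi(u)s(u)$ by a number that depends on $s$ only. The total loss of the algorithm is $L_T(\mathrm{OnlineRank})=\sum_{t=1}^T\ell\ell(\pi_t,s_t)$; for a single ranking $\pi$ played throughout, $L_T(\pi)=\sum_{t=1}^T\ell\ell(\pi,s_t)$; and $\pi^*\in\arg\min_{\pi\in S(V)}L_T(\pi)$ is a best ranking in hindsight. Algorithm $\mathrm{OnlineRank}(V,\eta,\mathrm{SortProc},T)$: set $w_0(u)=0$ for all $u\in V$. For $t=1,\dots,T$: output $\pi_t=\mathrm{SortProc}(V,w_{t-1})$; observe $s_t$; set $w_t(u)=w_{t-1}(u)+\eta s_t(u)$ for all $u\in V$. $\mathrm{QuickSort}(V,w)$, for $w:V\to\mathbb{R}$: if $V=\emptyset$ return the empty list. Otherwise choose a pivot $p\in V$ uniformly at random; for each $v\in V\setminus\{p\}$, with probability $e^{w(v)}/(e^{w(v)}+e^{w(p)})$ (independently for different $v$) add $v$ to $V_L$, otherwise add $v$ to $V_R$; return the concatenation of $\mathrm{QuickSort}(V_L,w)$, $p$, $\mathrm{QuickSort}(V_R,w)$, regarded as a ranking (the first element has position $1$, and so on). $\mathrm{PlackettLuce}(V,w)$, for $w:V\to\mathbb{R}$: start with $U=V$. For $i=1,\dots,n$: choose a random $u\in U$ with probability proportional to $e^{w(u)}$, set $\pi(u)=i$, and remove $u$ from $U$. Return $\pi$. *)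

theory Defs
  imports "HOL-Probability.Probability" "HOL-Library.Landau_Symbols" "HOL-Library.Time_Functions"
begin

section \<open>Rankings and the pairwise loss\<close>

definition rankings :: "'a set \<Rightarrow> ('a \<Rightarrow> nat) set" where
  "rankings V = {\<pi>. inj_on \<pi> V \<and> \<pi> ` V \<subseteq> {1..card V}}"

definition pair_loss :: "'a set \<Rightarrow> ('a \<Rightarrow> nat) \<Rightarrow> ('a \<Rightarrow> real) \<Rightarrow> real" where
  "pair_loss V \<pi> s =
     (\<Sum>(u, v) \<in> {(u, v) \<in> V \<times> V. u \<noteq> v}. of_bool (\<pi> u < \<pi> v) * max (s v - s u) 0)"

text \<open>A player is given by the ranking it uses in each step; a single ranking \<open>\<pi>\<close> played
  throughout is the player \<open>\<lambda>_. \<pi>\<close>.\<close>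

definition total_loss ::
    "'a set \<Rightarrow> (nat \<Rightarrow> 'a \<Rightarrow> real) \<Rightarrow> nat \<Rightarrow> (nat \<Rightarrow> 'a \<Rightarrow> nat) \<Rightarrow> real" where
  "total_loss V s T \<pi>s = (\<Sum>t = 1..T. pair_loss V (\<pi>s t) (s t))"

text \<open>The sum over unordered pairs: the summand is symmetric and vanishes on the diagonal, so
  the double sum counts every unordered pair exactly twice.\<close>

definition pair_variation :: "'a set \<Rightarrow> ('a \<Rightarrow> real) \<Rightarrow> real" where
  "pair_variation V s = (\<Sum>u\<in>V. \<Sum>v\<in>V. (s v - s u)\<^sup>2) / 2"

text \<open>An enumeration of the items, first element first, regarded as a ranking.\<close>

definition ranking_of :: "'a list \<Rightarrow> 'a \<Rightarrow> nat" where
  "ranking_of xs v = Suc (length (takeWhile (\<lambda>u. u \<noteq> v) xs))"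


section \<open>The two sorting procedures\<close>

text \<open>The probability \<open>e\<^sup>x / (e\<^sup>x + e\<^sup>y)\<close> that an item of weight \<open>x\<close> is put before one of
  weight \<open>y\<close>.\<close>

definition pref :: "real \<Rightarrow> real \<Rightarrow> real" where
  "pref x y = exp x / (exp x + exp y)"

text \<open>In \<open>quicksort\<close>, \<open>left v\<close> is the outcome of the independent coin of \<open>v\<close>: whether \<open>v\<close> is
  added to \<open>V\<^sub>L\<close>. The set \<open>V\<close> is meant to be finite.\<close>

function quicksort :: "('a \<Rightarrow> real) \<Rightarrow> 'a set \<Rightarrow> 'a list pmf" where
  "quicksort w V =
     (if infinite V \<or> V = {} then return_pmf []
      else do {
        p \<leftarrow> pmf_of_set V;
        left \<leftarrow> Pi_pmf (V - {p}) False (\<lambda>v. bernoulli_pmf (pref (w v) (w p)));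
        xs \<leftarrow> quicksort w {v \<in> V - {p}. left v};
        ys \<leftarrow> quicksort w {v \<in> V - {p}. \<not> left v};
        return_pmf (xs @ p # ys)
      })"
  by auto
termination
proof (relation "Wellfounded.measure (\<lambda>(w, V). card V)", goal_cases)
  case 1
  show ?case by simp
next
  case (2 w V p left)
  hence "{v \<in> V - {p}. left v} \<subset> V" by auto
  with 2 show ?case by (auto intro: psubset_card_mono)
next
  case (3 w V p left)
  hence "{v \<in> V - {p}. \<not> left v} \<subset> V" by auto
  with 3 show ?case by (auto intro: psubset_card_mono)
qed

declare quicksort.simps [simp del]

text \<open>Choice of an element of \<open>U\<close> with probability proportional to \<open>f\<close>.\<close>

definition proportional_pmf :: "'a set \<Rightarrow> ('a \<Rightarrow> real) \<Rightarrow> 'a pmf" where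
  "proportional_pmf U f = embed_pmf (\<lambda>u. if u \<in> U then f u / (\<Sum>v\<in>U. f v) else 0)"

lemma pmf_proportional_pmf:
  assumes "finite U" "U \<noteq> {}" "\<And>u. u \<in> U \<Longrightarrow> f u > 0"
  shows "pmf (proportional_pmf U f) u = (if u \<in> U then f u / (\<Sum>v\<in>U. f v) else 0)"
  unfolding proportional_pmf_def
proof (rule pmf_embed_pmf)
  let ?g = "\<lambda>u. if u \<in> U then f u / (\<Sum>v\<in>U. f v) else 0"
  have pos: "(\<Sum>v\<in>U. f v) > 0" using assms by (intro sum_pos) auto
  show nonneg: "?g x \<ge> 0" for x
    using pos assms(3)[of x] by (auto intro: divide_nonneg_pos less_imp_le)
  have "(\<integral>\<^sup>+ x. ennreal (?g x) \<partial>count_space UNIV) = (\<Sum>x\<in>U. ennreal (?g x))"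
    by (rule nn_integral_count_space'[OF assms(1)]) auto
  also have "\<dots> = ennreal (\<Sum>x\<in>U. ?g x)"
    by (rule sum_ennreal) (rule nonneg)
  also have "(\<Sum>x\<in>U. ?g x) = 1"
    using pos by (simp flip: sum_divide_distrib)
  finally show "(\<integral>\<^sup>+ x. ennreal (?g x) \<partial>count_space UNIV) = 1" by simp
qed

primrec plackett_luce_steps :: "('a \<Rightarrow> real) \<Rightarrow> nat \<Rightarrow> 'a set \<Rightarrow> 'a list pmf" where
  "plackett_luce_steps w 0 U = return_pmf []"
| "plackett_luce_steps w (Suc k) U = do {
     u \<leftarrow> proportional_pmf U (\<lambda>u. exp (w u));
     xs \<leftarrow> plackett_luce_steps w k (U - {u});
     return_pmf (u # xs)
   }"

definition plackett_luce :: "('a \<Rightarrow> real) \<Rightarrow> 'a set \<Rightarrow> 'a list pmf" where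
  "plackett_luce w V = plackett_luce_steps w (card V) V"

datatype sort_proc = QuickSort | PlackettLuce

fun sort_pmf :: "sort_proc \<Rightarrow> ('a \<Rightarrow> real) \<Rightarrow> 'a set \<Rightarrow> 'a list pmf" where
  "sort_pmf QuickSort w V = quicksort w V"
| "sort_pmf PlackettLuce w V = plackett_luce w V"


section \<open>OnlineRank\<close>

primrec weight :: "real \<Rightarrow> (nat \<Rightarrow> 'a \<Rightarrow> real) \<Rightarrow> nat \<Rightarrow> 'a \<Rightarrow> real" where
  "weight \<eta> s 0 u = 0"
| "weight \<eta> s (Suc t) u = weight \<eta> s t u + \<eta> * s (Suc t) u"

text \<open>The joint distribution of the rankings played in steps \<open>1, \<dots>, T\<close>; the values outside these
  steps are irrelevant.\<close>

primrec online_rank ::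
    "sort_proc \<Rightarrow> 'a set \<Rightarrow> real \<Rightarrow> (nat \<Rightarrow> 'a \<Rightarrow> real) \<Rightarrow> nat \<Rightarrow> (nat \<Rightarrow> 'a \<Rightarrow> nat) pmf" where
  "online_rank sp V \<eta> s 0 = return_pmf (\<lambda>_ _. 0)"
| "online_rank sp V \<eta> s (Suc T) = do {
     \<pi>s \<leftarrow> online_rank sp V \<eta> s T;
     xs \<leftarrow> sort_pmf sp (weight \<eta> s T) V;
     return_pmf (\<pi>s(Suc T := ranking_of xs))
   }"


section \<open>Implementation with running time\<close>

text \<open>
  The items are kept in a list together with their current weights. A randomised program
  returns a distribution over pairs of a result and a number of elementary steps. The steps are
  counted as in \<^theory>\<open>HOL-Library.Time_Functions\<close>, whose time functions are used for the
  list operations: every call of a function, recursive calls included, costs one step, and this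
  covers the bounded number of primitive operations that the call performs besides the calls that
  are counted separately. Primitive are constructors and their inversion, arithmetic and comparison
  of natural numbers, arithmetic and exponentials of real numbers (as on a real RAM), evaluation
  of the feedback at one item, the toss of one coin of given bias, and the choice of a uniformly
  random number below a given number. Non-recursive auxiliary functions (\<open>pref\<close>, \<open>total\<close>,
  \<open>node\<close>, \<open>fst\<close>, \<open>hd\<close>, \<dots>) perform boundedly many of these and are regarded as inlined.
\<close>

subsection \<open>QuickSort\<close>

text \<open>\<open>partition_impl y xs\<close> splits \<open>xs\<close> around a pivot of weight \<open>y\<close>.\<close>

primrec partition_impl ::
    "real \<Rightarrow> ('a \<times> real) list \<Rightarrow> ((('a \<times> real) list \<times> ('a \<times> real) list) \<times> nat) pmf" where
  "partition_impl y [] = return_pmf (([], []), 1)"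
| "partition_impl y (a # xs) = do {
     left \<leftarrow> bernoulli_pmf (pref (snd a) y);
     ((ls, rs), c) \<leftarrow> partition_impl y xs;
     return_pmf (if left then (a # ls, rs) else (ls, a # rs), c + 1)
   }"

lemma length_partition_impl:
  "((ls, rs), c) \<in> set_pmf (partition_impl y xs) \<Longrightarrow> length ls + length rs = length xs"
proof (induction xs arbitrary: ls rs c)
  case (Cons a xs)
  from Cons.prems obtain left ls' rs' c' where
    *: "((ls', rs'), c') \<in> set_pmf (partition_impl y xs)"
       "(ls, rs) = (if left then (a # ls', rs') else (ls', a # rs'))"
    by (auto simp: set_bind_pmf)
  show ?case using Cons.IH[OF *(1)] *(2) by (cases left) auto
qed simp

function quicksort_impl :: "('a \<times> real) list \<Rightarrow> ('a list \<times> nat) pmf" where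
  "quicksort_impl xs =
     (if xs = [] then return_pmf ([], 1)
      else do {
        i \<leftarrow> pmf_of_set {..<length xs};
        ((ls, rs), c) \<leftarrow> partition_impl (snd (xs ! i)) (take i xs @ drop (Suc i) xs);
        (ys, c\<^sub>l) \<leftarrow> quicksort_impl ls;
        (zs, c\<^sub>r) \<leftarrow> quicksort_impl rs;
        return_pmf (ys @ fst (xs ! i) # zs,
          T_length xs + T_nth xs i + T_take i xs + T_drop (Suc i) xs
            + T_append (take i xs) (drop (Suc i) xs)
            + c + c\<^sub>l + c\<^sub>r + T_append ys (fst (xs ! i) # zs) + 1)
      })"
  by auto
termination
proof (relation "Wellfounded.measure length", goal_cases)
  case 1
  show ?case by simp
qed (auto simp: lessThan_empty_iff dest!: length_partition_impl)

declare quicksort_impl.simps [simp del]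

subsection \<open>Plackett-Luce\<close>

text \<open>
  Executed literally, each of the \<open>n\<close> draws would take linear time. The items that are still
  available are therefore kept at the leaves of a balanced binary tree, each inner node of which
  stores the sum of the values \<open>e\<^sup>w\<close> below it. A draw descends from the root,
  tossing a coin at each inner node, replaces the leaf that it reaches by an empty tree
  and updates the sums on its way back.
\<close>

datatype 'a sum_tree = Tip | Leaf 'a real | Node "'a sum_tree" real "'a sum_tree"

fun total :: "'a sum_tree \<Rightarrow> real" where
  "total Tip = 0"
| "total (Leaf a x) = x"
| "total (Node l x r) = x"

definition node :: "'a sum_tree \<Rightarrow> 'a sum_tree \<Rightarrow> 'a sum_tree" where
  "node l r = Node l (total l + total r) r"

text \<open>\<open>build n xs\<close> builds a balanced tree from the first \<open>n\<close> elements of \<open>xs\<close> and also returns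
  the remaining elements.\<close>

fun build :: "nat \<Rightarrow> ('a \<times> real) list \<Rightarrow> 'a sum_tree \<times> ('a \<times> real) list" where
  "build n xs =
     (if n = 0 then (Tip, xs)
      else if n = 1 then (Leaf (fst (hd xs)) (snd (hd xs)), tl xs)
      else let (l, ys) = build (n div 2) xs; (r, zs) = build (n - n div 2) ys
           in (node l r, zs))"

declare build.simps [simp del]

fun T_build :: "nat \<Rightarrow> ('a \<times> real) list \<Rightarrow> nat" where
  "T_build n xs =
     (if n \<le> 1 then 1
      else T_build (n div 2) xs + T_build (n - n div 2) (snd (build (n div 2) xs)) + 1)"

declare T_build.simps [simp del]

text \<open>The case \<open>Tip\<close> is never reached from a tree with positive total.\<close>

primrec draw :: "'a sum_tree \<Rightarrow> (('a \<times> 'a sum_tree) \<times> nat) pmf" where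
  "draw Tip = return_pmf ((undefined, Tip), 1)"
| "draw (Leaf a x) = return_pmf ((a, Tip), 1)"
| "draw (Node l x r) = do {
     left \<leftarrow> bernoulli_pmf (total l / x);
     if left
     then do { ((a, l'), c) \<leftarrow> draw l; return_pmf ((a, node l' r), c + 1) }
     else do { ((a, r'), c) \<leftarrow> draw r; return_pmf ((a, node l r'), c + 1) }
   }"

primrec draws :: "nat \<Rightarrow> 'a sum_tree \<Rightarrow> ('a list \<times> nat) pmf" where
  "draws 0 tr = return_pmf ([], 1)"
| "draws (Suc k) tr = do {
     ((a, tr'), c) \<leftarrow> draw tr;
     (xs, d) \<leftarrow> draws k tr';
     return_pmf (a # xs, c + d + 1)
   }"

definition plackett_luce_impl :: "('a \<times> real) list \<Rightarrow> ('a list \<times> nat) pmf" where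
  "plackett_luce_impl ws = (
     let n = length ws; xs = map (map_prod id exp) ws
     in map_pmf (map_prod id (\<lambda>c. T_length ws + T_map (\<lambda>_. 1) ws + T_build n xs + c + 1))
          (draws n (fst (build n xs))))"

subsection \<open>One step of OnlineRank\<close>

text \<open>A step computes the list of all items in the order in which they are ranked, and the weights
  for the next step.\<close>

fun sort_impl :: "sort_proc \<Rightarrow> ('a \<times> real) list \<Rightarrow> ('a list \<times> nat) pmf" where
  "sort_impl QuickSort ws = quicksort_impl ws"
| "sort_impl PlackettLuce ws = plackett_luce_impl ws"

definition step_impl ::
    "sort_proc \<Rightarrow> real \<Rightarrow> ('a \<Rightarrow> real) \<Rightarrow> ('a \<times> real) list
       \<Rightarrow> (('a list \<times> ('a \<times> real) list) \<times> nat) pmf" where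
  "step_impl sp \<eta> s ws = do {
     (xs, c) \<leftarrow> sort_impl sp ws;
     return_pmf ((xs, map (\<lambda>(v, x). (v, x + \<eta> * s v)) ws), c + T_map (\<lambda>_. 1) ws + 1)
   }"

text \<open>The weights after step \<open>t\<close>, as stored for the items \<open>vs\<close>.\<close>

definition stored :: "real \<Rightarrow> (nat \<Rightarrow> 'a \<Rightarrow> real) \<Rightarrow> 'a list \<Rightarrow> nat \<Rightarrow> ('a \<times> real) list" where
  "stored \<eta> s vs t = map (\<lambda>v. (v, weight \<eta> s t v)) vs"

end

(* Under both procedures u precedes v with probability e^w(u) / (e^w(u) + e^w(v)). For QuickSort,
   a pivot p other than u, v either separates them, or leaves them together, and this probability
   is a fixed point of the resulting recursion. Hence OnlineRank plays the exponential weights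
   algorithm with two experts on every pair, and the regret of a pair is at most
   ln 2 / eta + (eta / 2) * sum of (s_t(v) - s_t(u))^2; summing over the pairs and inserting eta
   gives the bound.

   QuickSort has no consistent order of the items to rely on, but its coins form a random
   tournament. Every three players contain a directed path with two edges, so for a random pivot
   the expected product of the sizes of the two parts is at least about n^2 / 6, which yields
   expected time O(n log n). The sum tree of Plackett-Luce keeps its logarithmic height. *)

theory Submission
  imports Defs "HOL-Combinatorics.Multiset_Permutations"
begin

text \<open>The loss is a sum over pairs, so its expectation sees a random ranking only through the
  probabilities that one item precedes another. There are at most n^2 / 2 pairs, hence the two error
  terms are n^2 ln 2 / (2 \<eta>) and \<eta> T M / 2, and the prescribed \<eta> is the one that
  makes them equal.

  For the time of QuickSort, no class of good pivots can be singled out beforehand, and a single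
  pivot may well leave one part empty. The product l r of the part sizes is therefore kept until the
  average over the pivot is taken. With potential 21 n ln n the gain of a split is about 42 l r / n,
  on average about 7 n, which is the linear work of one call.

  The programs are treated twice: projected to their results they have the law of the abstract
  procedures, and their step counts are bounded separately. All distributions have finite support,
  so integrability is never an issue.\<close>

lemma expectation_bind:
  fixes h :: "'b \<Rightarrow> real"
  assumes "finite (set_pmf p)" "\<And>x. x \<in> set_pmf p \<Longrightarrow> finite (set_pmf (f x))"
  shows "measure_pmf.expectation (bind_pmf p f) h =
    measure_pmf.expectation p (\<lambda>x. measure_pmf.expectation (f x) h)"
  using pmf_expectation_bind[OF assms(1,2) subset_refl, where h = h]
    integral_measure_pmf[OF assms(1), where M = p and f = "\<lambda>x. measure_pmf.expectation (f x) h"]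
  by simp

lemma expectation_mono:
  fixes f g :: "'a \<Rightarrow> real"
  assumes "finite (set_pmf p)" "\<And>x. x \<in> set_pmf p \<Longrightarrow> f x \<le> g x"
  shows "measure_pmf.expectation p f \<le> measure_pmf.expectation p g"
  using assms by (intro integral_mono_AE integrable_measure_pmf_finite) (auto simp: AE_measure_pmf_iff)

lemma expectation_cong:
  fixes f g :: "'a \<Rightarrow> real"
  assumes "\<And>x. x \<in> set_pmf p \<Longrightarrow> f x = g x"
  shows "measure_pmf.expectation p f = measure_pmf.expectation p g"
  using assms by (intro integral_cong_AE) (auto simp: AE_measure_pmf_iff)

lemma expectation_of_const:
  fixes f :: "'a \<Rightarrow> real"
  assumes "\<And>x. x \<in> set_pmf p \<Longrightarrow> f x = c"
  shows "measure_pmf.expectation p f = c"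
  using expectation_cong[of p f "\<lambda>_. c"] assms by simp

lemma pref_bounds: "0 < pref x y" "pref x y < 1" "0 \<le> pref x y" "pref x y \<le> 1"
  by (auto simp: pref_def add_pos_pos divide_simps)

lemma pref_commute: "pref y x = 1 - pref x y"
proof -
  have "exp x + exp y > 0" by (simp add: add_pos_pos)
  then show ?thesis by (simp add: pref_def field_simps)
qed

section \<open>Pairwise order probabilities\<close>

lemma ranking_of_Nil [simp]: "ranking_of [] v = 1"
  and ranking_of_Cons [simp]:
    "ranking_of (x # xs) v = (if x = v then 1 else Suc (ranking_of xs v))"
  by (simp_all add: ranking_of_def)

lemma ranking_of_pos [simp]: "0 < ranking_of xs v" "Suc 0 \<le> ranking_of xs v"
  by (simp_all add: ranking_of_def)

lemma ranking_of_le: "v \<in> set xs \<Longrightarrow> ranking_of xs v \<le> length xs"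
  by (induction xs) auto

lemma ranking_of_append:
  "ranking_of (xs @ ys) v = (if v \<in> set xs then ranking_of xs v else length xs + ranking_of ys v)"
  by (induction xs) auto

lemma finite_set_Pi_pmf:
  assumes "finite A" "\<And>x. x \<in> A \<Longrightarrow> finite (set_pmf (p x))"
  shows "finite (set_pmf (Pi_pmf A d p))"
  using assms by (simp add: set_Pi_pmf) (auto intro!: finite_PiE_dflt)

lemma finite_set_pmf_bool: "finite (set_pmf (p :: bool pmf))"
  by (rule finite_subset[OF subset_UNIV]) simp

lemma set_quicksort:
  "finite V \<Longrightarrow> xs \<in> set_pmf (quicksort w V) \<Longrightarrow> xs \<in> permutations_of_set V"
proof (induction V arbitrary: xs rule: finite_psubset_induct)
  case (psubset V)
  show ?case
  proof (cases "V = {}")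
    case True
    then show ?thesis using psubset.prems by (simp add: quicksort.simps[of w "{}"])
  next
    case False
    then obtain p left ys zs where *: "p \<in> V" "xs = ys @ p # zs"
      "ys \<in> set_pmf (quicksort w {v \<in> V - {p}. left v})"
      "zs \<in> set_pmf (quicksort w {v \<in> V - {p}. \<not> left v})"
      using psubset.prems psubset.hyps
      by (subst (asm) quicksort.simps) auto
    have "{v \<in> V - {p}. left v} \<subset> V" "{v \<in> V - {p}. \<not> left v} \<subset> V" using *(1) by auto
    with psubset.IH * have "ys \<in> permutations_of_set {v \<in> V - {p}. left v}"
      "zs \<in> permutations_of_set {v \<in> V - {p}. \<not> left v}" by blast+
    then show ?thesis using * by (auto simp: permutations_of_set_def)
  qed
qed

lemma finite_set_quicksort: "finite V \<Longrightarrow> finite (set_pmf (quicksort w V))"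
  by (rule finite_subset[of _ "permutations_of_set V"]) (auto dest: set_quicksort)

text \<open>Only the coins of \<open>u\<close> and \<open>v\<close> are read: once these two
  coordinates are split off the product, the integrand is constant in all others.\<close>

lemma expectation_Pi_bernoulli2:
  fixes g :: "bool \<Rightarrow> bool \<Rightarrow> real"
  assumes "finite A" "u \<in> A" "v \<in> A" "u \<noteq> v" "\<And>x. 0 \<le> q x" "\<And>x. q x \<le> 1"
  shows "measure_pmf.expectation (Pi_pmf A d (\<lambda>x. bernoulli_pmf (q x))) (\<lambda>f. g (f u) (f v)) =
    g True True * q u * q v + g True False * q u * (1 - q v)
    + g False True * (1 - q u) * q v + g False False * (1 - q u) * (1 - q v)"
proof -
  define B where "B = A - {u, v}"
  have A: "A = insert u (insert v B)" "u \<notin> insert v B" "v \<notin> B" "finite B" "finite (insert v B)"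
    using assms by (auto simp: B_def)
  have fin: "finite (set_pmf (Pi_pmf X d (\<lambda>x. bernoulli_pmf (q x))))" if "finite X" for X
    by (rule finite_set_Pi_pmf[OF that finite_set_pmf_bool])
  show ?thesis
    unfolding A(1) Pi_pmf_insert'[OF A(5,2)] Pi_pmf_insert'[OF A(4,3)]
    using A assms(4,5,6) fin[OF A(4)]
    by (simp add: expectation_bind finite_set_pmf_bool algebra_simps)
qed

lemma expectation_Pi_bernoulli1:
  fixes g :: "bool \<Rightarrow> real"
  assumes "finite A" "u \<in> A" "\<And>x. 0 \<le> q x" "\<And>x. q x \<le> 1"
  shows "measure_pmf.expectation (Pi_pmf A d (\<lambda>x. bernoulli_pmf (q x))) (\<lambda>f. g (f u)) =
    g True * q u + g False * (1 - q u)"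
proof -
  have "measure_pmf.expectation (Pi_pmf A d (\<lambda>x. bernoulli_pmf (q x))) (\<lambda>f. g (f u))
    = measure_pmf.expectation (map_pmf (\<lambda>f. f u) (Pi_pmf A d (\<lambda>x. bernoulli_pmf (q x)))) g"
    by simp
  then show ?thesis using assms by (simp add: Pi_pmf_component)
qed

text \<open>If the pivot separates the two items, the odds are a (1 - b) : (1 - a) b = e^x e^z : e^z
  e^y = e^x : e^y, whatever z is. So separating pivots already give the right conditional
  probability, and the others reproduce it by recursion.\<close>

lemma pref_pivot:
  assumes "a = pref x z" "b = pref y z"
  shows "a * (1 - b) + (a * b + (1 - a) * (1 - b)) * pref x y = pref x y"
proof -
  have pos: "exp x + exp z > 0" "exp y + exp z > 0" "exp x + exp y > 0"
    by (simp_all add: add_pos_pos)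
  have nz: "exp x + exp z \<noteq> 0" "exp y + exp z \<noteq> 0" "exp x + exp y \<noteq> 0" using pos by linarith+
  show ?thesis
    unfolding assms pref_def using nz
    by (simp add: divide_simps) (simp add: algebra_simps)
qed

lemma expectation_before_quicksort:
  assumes "finite V" "u \<in> V" "v \<in> V" "u \<noteq> v"
  shows "measure_pmf.expectation (quicksort w V)
           (\<lambda>xs. of_bool (ranking_of xs u < ranking_of xs v)) = pref (w u) (w v)"
  using assms
proof (induction V rule: finite_psubset_induct)
  case (psubset V)
  let ?E = "measure_pmf.expectation"
  let ?b = "\<lambda>xs. of_bool (ranking_of xs u < ranking_of xs v) :: real"
  let ?coins = "\<lambda>p. Pi_pmf (V - {p}) False (\<lambda>x. bernoulli_pmf (pref (w x) (w p)))"
  let ?L = "\<lambda>p left. {x \<in> V - {p}. left x}" and ?R = "\<lambda>p left. {x \<in> V - {p}. \<not> left x}"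
  define g where "g p left = ?E (quicksort w (?L p left))
     (\<lambda>xs. ?E (quicksort w (?R p left)) (\<lambda>ys. ?b (xs @ p # ys)))" for p left
  have fin: "finite (set_pmf (?coins p))" for p
    using psubset.hyps by (intro finite_set_Pi_pmf finite_set_pmf_bool) auto
  have finq: "finite (set_pmf (quicksort w {x \<in> V. P x}))" for P
    using psubset.hyps by (intro finite_set_quicksort) auto
  \<comment> \<open>\<open>g p left\<close> is the conditional probability given the pivot and all
    coins. A pivot equal to or separating the two items decides their order; otherwise the induction
    hypothesis applies to the part that contains both.\<close>
  have g: "g p left = (if p = u then of_bool (\<not> left v) else if p = v then of_bool (left u)
      else if left u \<longleftrightarrow> left v then pref (w u) (w v) else of_bool (left u))" if p: "p \<in> V" for p left
  proof -
    have sets: "set xs = ?L p left" "set ys = ?R p left"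
      if "xs \<in> set_pmf (quicksort w (?L p left))" "ys \<in> set_pmf (quicksort w (?R p left))" for xs ys
      using that psubset.hyps by (auto dest!: set_quicksort[rotated] simp: permutations_of_set_def)
    have sub: "?L p left \<subset> V" "?R p left \<subset> V" using p by auto
    consider "p = u" | "p = v" | "p \<noteq> u" "p \<noteq> v" "left u" "left v" | "p \<noteq> u" "p \<noteq> v" "\<not> left u" "\<not> left v"
      | "p \<noteq> u" "p \<noteq> v" "left u \<noteq> left v" by blast
    then show ?thesis
    proof cases
      case 3
      have "g p left = ?E (quicksort w (?L p left)) (\<lambda>xs. ?E (quicksort w (?R p left)) (\<lambda>ys. ?b xs))"
        unfolding g_def using 3 psubset.prems
        by (intro expectation_cong) (auto simp: ranking_of_append sets)
      also have "\<dots> = pref (w u) (w v)"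
        using psubset.IH[OF sub(1)] 3 psubset.prems by simp
      finally show ?thesis using 3 by simp
    next
      case 4
      have "g p left = ?E (quicksort w (?L p left)) (\<lambda>xs. ?E (quicksort w (?R p left)) (\<lambda>ys. ?b ys))"
        unfolding g_def using 4 psubset.prems
        by (intro expectation_cong) (auto simp: ranking_of_append sets)
      also have "\<dots> = pref (w u) (w v)"
        using psubset.IH[OF sub(2)] 4 psubset.prems by simp
      finally show ?thesis using 4 by simp
    \<comment> \<open>In these cases the pivot and the coins have fixed the order, so the indicator
      is the same for all outputs of the recursive calls.\<close>
    qed (unfold g_def, (intro expectation_of_const; use psubset.prems in
          \<open>auto simp: ranking_of_append sets not_less less_Suc_eq_le
             intro: ranking_of_le le_trans[OF ranking_of_le] trans_le_add1\<close>)+)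
  qed
  have "?E (?coins p) (g p) = pref (w u) (w v)" if p: "p \<in> V" for p
  proof -
    consider "p = u" | "p = v" | "p \<noteq> u" "p \<noteq> v" by blast
    then show ?thesis
    proof cases
      case 1
      have "?E (?coins p) (g p) = ?E (?coins p) (\<lambda>f. of_bool (\<not> f v))"
        using 1 g[OF p] by (intro expectation_cong) auto
      then show ?thesis using 1 psubset.prems psubset.hyps pref_commute[of "w v" "w u"]
        by (simp add: expectation_Pi_bernoulli1[where g = "\<lambda>x. of_bool (\<not> x)"] pref_bounds)
    next
      case 2
      have "?E (?coins p) (g p) = ?E (?coins p) (\<lambda>f. of_bool (f u))"
        using 2 g[OF p] psubset.prems by (intro expectation_cong) auto
      then show ?thesis using 2 psubset.prems psubset.hyps
        by (simp add: expectation_Pi_bernoulli1[where g = "\<lambda>x. of_bool x"] pref_bounds)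
    next
      case 3
      let ?g = "\<lambda>x y. if x \<longleftrightarrow> y then pref (w u) (w v) else of_bool x"
      have "?E (?coins p) (g p) = ?E (?coins p) (\<lambda>f. ?g (f u) (f v))"
        using 3 g[OF p] by (intro expectation_cong) auto
      also have "\<dots> = pref (w u) (w v)"
        using 3 psubset.prems psubset.hyps pref_pivot[OF refl refl, of "w u" "w p" "w v"]
        by (subst expectation_Pi_bernoulli2) (auto simp: pref_bounds algebra_simps)
      finally show ?thesis .
    qed
  qed
  moreover have "?E (quicksort w V) ?b = ?E (pmf_of_set V) (\<lambda>p. ?E (?coins p) (g p))"
    using psubset.hyps psubset.prems finq fin
    by (subst quicksort.simps) (auto simp: expectation_bind g_def[abs_def])
  moreover have "set_pmf (pmf_of_set V) = V"
    using psubset.hyps psubset.prems by (intro set_pmf_of_set) auto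
  ultimately show ?case
    by (auto intro: expectation_of_const)
qed

section \<open>Order probabilities of successive proportional draws\<close>

lemma set_proportional_pmf:
  assumes "finite U" "U \<noteq> {}" "\<And>u. u \<in> U \<Longrightarrow> f u > 0"
  shows "set_pmf (proportional_pmf U f) = U"
proof -
  have "(\<Sum>u\<in>U. f u) > 0" using assms by (intro sum_pos) auto
  then show ?thesis using assms(3)
    by (auto simp: set_pmf_iff pmf_proportional_pmf[OF assms] split: if_splits) fastforce
qed

lemma expectation_proportional_pmf:
  fixes h :: "'a \<Rightarrow> real"
  assumes "finite U" "U \<noteq> {}" "\<And>u. u \<in> U \<Longrightarrow> f u > 0"
  shows "measure_pmf.expectation (proportional_pmf U f) h = (\<Sum>u\<in>U. f u * h u) / (\<Sum>u\<in>U. f u)"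
  using assms
  by (subst integral_measure_pmf[of U])
     (auto simp: set_proportional_pmf pmf_proportional_pmf sum_divide_distrib intro!: sum.cong)

lemma set_plackett_luce_steps:
  "finite U \<Longrightarrow> xs \<in> set_pmf (plackett_luce_steps w (card U) U) \<Longrightarrow> xs \<in> permutations_of_set U"
proof (induction "card U" arbitrary: U xs)
  case 0
  then show ?case by simp
next
  case (Suc k)
  then have U: "U \<noteq> {}" by auto
  from Suc.prems Suc.hyps(2)[symmetric] Suc.prems obtain u ys where *: "u \<in> U" "xs = u # ys"
    "ys \<in> set_pmf (plackett_luce_steps w k (U - {u}))"
    by (auto simp: set_proportional_pmf U)
  moreover have "k = card (U - {u})" using *(1) Suc.prems Suc.hyps(2) by simp
  ultimately show ?case using Suc.hyps(1)[of "U - {u}" ys] Suc.prems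
    by (auto simp: permutations_of_set_def)
qed

lemma set_sort_pmf:
  "finite V \<Longrightarrow> xs \<in> set_pmf (sort_pmf sp w V) \<Longrightarrow> xs \<in> permutations_of_set V"
  by (cases sp) (auto simp: plackett_luce_def dest: set_quicksort set_plackett_luce_steps)

lemma finite_set_sort_pmf: "finite V \<Longrightarrow> finite (set_pmf (sort_pmf sp w V))"
  by (rule finite_subset[of _ "permutations_of_set V"]) (auto dest: set_sort_pmf)

text \<open>Condition on the first draw: \<open>u\<close> settles the order one way,
  \<open>v\<close> the other, and any other item leaves the same question for a smaller set. So the
  answer p solves e^(w u) + R p = p S, where S is the total and R the total without \<open>u\<close>
  and \<open>v\<close>.\<close>

lemma expectation_before_plackett_luce:
  assumes "finite V" "u \<in> V" "v \<in> V" "u \<noteq> v" "card V = k"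
  shows "measure_pmf.expectation (plackett_luce_steps w k V)
           (\<lambda>xs. of_bool (ranking_of xs u < ranking_of xs v)) = pref (w u) (w v)"
  using assms
proof (induction k arbitrary: V)
  case 0
  then show ?case by auto
next
  case (Suc k)
  let ?E = "measure_pmf.expectation"
  let ?b = "\<lambda>xs. of_bool (ranking_of xs u < ranking_of xs v) :: real"
  let ?g = "\<lambda>x. if x = u then 1 else if x = v then 0 else pref (w u) (w v)"
  have V: "V \<noteq> {}" using Suc.prems by auto
  have S: "set_pmf (proportional_pmf V (\<lambda>x. exp (w x))) = V"
    using V Suc.prems(1) by (simp add: set_proportional_pmf)
  have card: "card (V - {x}) = k" if "x \<in> V" for x using that Suc.prems by simp
  have fin: "finite (set_pmf (plackett_luce_steps w k (V - {x})))" if "x \<in> V" for x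
    using Suc.prems(1) card[OF that] set_plackett_luce_steps[of "V - {x}" _ w]
    by (intro finite_subset[OF _ finite_permutations_of_set[of "V - {x}"]]) auto
  have inner: "?E (plackett_luce_steps w k (V - {x})) (\<lambda>xs. ?b (x # xs)) = ?g x" if x: "x \<in> V" for x
  proof -
    consider "x = u" | "x = v" | "x \<noteq> u" "x \<noteq> v" by blast
    then show ?thesis
    proof cases
      case 3
      then show ?thesis using Suc.IH[of "V - {x}"] Suc.prems(1-4) card[OF x] by simp
    qed (use Suc.prems(4) in simp_all)
  qed
  let ?S = "\<Sum>x\<in>V. exp (w x)" and ?R = "\<Sum>x\<in>V - {u} - {v}. exp (w x)" and ?p = "pref (w u) (w v)"
  have split: "(\<Sum>x\<in>V. f x) = f u + (f v + (\<Sum>x\<in>V - {u} - {v}. f x))" for f :: "'a \<Rightarrow> real"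
    using sum.remove[of V u f] sum.remove[of "V - {u}" v f] Suc.prems by simp
  have "?E (plackett_luce_steps w (Suc k) V) ?b =
    ?E (proportional_pmf V (\<lambda>x. exp (w x))) (\<lambda>x. ?E (plackett_luce_steps w k (V - {x})) (\<lambda>xs. ?b (x # xs)))"
    unfolding plackett_luce_steps.simps
  proof (subst expectation_bind, unfold S)
    fix x assume "x \<in> V"
    then show "finite (set_pmf (plackett_luce_steps w k (V - {x}) \<bind> (\<lambda>xs. return_pmf (x # xs))))"
      using fin by simp
  next
    show "?E (proportional_pmf V (\<lambda>x. exp (w x)))
        (\<lambda>x. ?E (plackett_luce_steps w k (V - {x}) \<bind> (\<lambda>xs. return_pmf (x # xs))) ?b) =
      ?E (proportional_pmf V (\<lambda>x. exp (w x))) (\<lambda>x. ?E (plackett_luce_steps w k (V - {x})) (\<lambda>xs. ?b (x # xs)))"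
      using fin S by (intro expectation_cong) (simp add: expectation_bind del: ranking_of_Cons)
  qed (use Suc.prems(1) in simp)
  also have "\<dots> = ?E (proportional_pmf V (\<lambda>x. exp (w x))) ?g"
    using V Suc.prems(1) inner S by (intro expectation_cong) simp
  also have "\<dots> = (\<Sum>x\<in>V. exp (w x) * ?g x) / ?S"
    using V Suc.prems(1) by (simp add: expectation_proportional_pmf)
  also have "(\<Sum>x\<in>V. exp (w x) * ?g x) = exp (w u) + (\<Sum>x\<in>V - {u} - {v}. exp (w x) * ?g x)"
    unfolding split using Suc.prems(4) by simp
  also have "(\<Sum>x\<in>V - {u} - {v}. exp (w x) * ?g x) = ?R * ?p"
    unfolding sum_distrib_right by (intro sum.cong) auto
  \<comment> \<open>The fixed-point equation reduces to p (e^(w u) + e^(w v)) = e^(w u), which is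
    the definition of \<open>pref\<close>.\<close>
  also have "exp (w u) + ?R * ?p = ?p * ?S"
  proof -
    have "exp (w u) + exp (w v) \<noteq> 0"
      using add_pos_pos[OF exp_gt_zero exp_gt_zero, of "w u" "w v"] by linarith
    then have "?p * (exp (w u) + exp (w v)) = exp (w u)" by (simp add: pref_def)
    then show ?thesis unfolding split distrib_left by (metis add.assoc mult.commute)
  qed
  also have "?p * ?S / ?S = ?p"
    using sum_pos[OF Suc.prems(1) V, of "\<lambda>x. exp (w x)"] by simp
  finally show ?case .
qed

section \<open>Expected loss of the algorithm\<close>

lemma expectation_before_sort:
  assumes "finite V" "u \<in> V" "v \<in> V" "u \<noteq> v"
  shows "measure_pmf.expectation (sort_pmf sp w V)
           (\<lambda>xs. of_bool (ranking_of xs u < ranking_of xs v)) = pref (w u) (w v)"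
  using assms
  by (cases sp) (simp_all add: plackett_luce_def expectation_before_quicksort
      expectation_before_plackett_luce)

text \<open>By linearity only the pairwise marginals enter, and these agree for both procedures; the
  right-hand side is free of \<open>sp\<close>, so the regret analysis is common to both.\<close>

lemma expectation_pair_loss:
  assumes "finite V"
  shows "measure_pmf.expectation (sort_pmf sp w V) (\<lambda>xs. pair_loss V (ranking_of xs) s) =
    (\<Sum>(u, v) \<in> {(u, v) \<in> V \<times> V. u \<noteq> v}. pref (w u) (w v) * max (s v - s u) 0)"
  unfolding pair_loss_def using assms
  by (subst Bochner_Integration.integral_sum)
     (auto intro!: integrable_measure_pmf_finite finite_set_sort_pmf sum.cong
        simp: expectation_before_sort)

lemma finite_set_online_rank:
  "finite V \<Longrightarrow> finite (set_pmf (online_rank sp V \<eta> s T))"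
  by (induction T) (auto simp: finite_set_sort_pmf)

text \<open>The feedback is a fixed sequence, so the weights are deterministic and each ranking is
  drawn independently of the earlier ones. The index \<open>t - 1\<close> reflects that step
  \<open>t\<close> sees only the feedback before it.\<close>

lemma expectation_total_loss:
  assumes "finite V"
  shows "measure_pmf.expectation (online_rank sp V \<eta> s T) (total_loss V s T) =
    (\<Sum>t = 1..T. measure_pmf.expectation (sort_pmf sp (weight \<eta> s (t - 1)) V)
       (\<lambda>xs. pair_loss V (ranking_of xs) (s t)))"
proof (induction T)
  case 0
  then show ?case by (simp add: total_loss_def)
next
  case (Suc T)
  have upd: "total_loss V s (Suc T) (\<pi>s(Suc T := \<pi>)) = total_loss V s T \<pi>s + pair_loss V \<pi> (s (Suc T))"
    for \<pi>s \<pi>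
    by (simp add: total_loss_def)
  have fin: "finite (set_pmf (online_rank sp V \<eta> s T))"
    "finite (set_pmf (sort_pmf sp w V))" for w
    using assms by (simp_all add: finite_set_online_rank finite_set_sort_pmf)
  have int: "integrable (measure_pmf (online_rank sp V \<eta> s T)) f"
     "integrable (measure_pmf (sort_pmf sp w V)) g"
    for f :: "(nat \<Rightarrow> 'a \<Rightarrow> nat) \<Rightarrow> real" and w and g :: "'a list \<Rightarrow> real"
    using fin by (simp_all add: integrable_measure_pmf_finite)
  show ?case
    by (simp add: expectation_bind fin upd int Suc.IH)
qed

section \<open>Regret\<close>

text \<open>With p = e^d / (1 + e^d), the increment of the potential is ln (1 - p + p e^x), the
  cumulant generating function of a Bernoulli variable. Its derivative at 0 is p, and a quadratic
  remainder x^2 / 2 is already enough for the intended regret.\<close>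

lemma softplus_le:
  fixes d x :: real
  shows "ln (1 + exp (d + x)) \<le> ln (1 + exp d) + exp d / (1 + exp d) * x + x\<^sup>2 / 2"
proof -
  \<comment> \<open>The sign of x matters: e^x is below its quadratic Taylor polynomial only for x
    \<le> 0, where the cubic remainder is not positive. Then ln y \<le> y - 1 finishes.\<close>
  have half: "ln (1 - p + p * exp x) \<le> p * (x + x\<^sup>2 / 2)"
    if x: "x \<le> 0" and p: "0 \<le> p" "p < 1" for p x :: real
  proof -
    have "exp x \<le> 1 + x + x\<^sup>2 / 2"
    proof (cases "x = 0")
      case False
      obtain t where t: "\<bar>t\<bar> \<le> \<bar>x\<bar>" "exp x = (\<Sum>m<3. x ^ m / fact m) + exp t / fact 3 * x ^ 3"
        using Maclaurin_exp_le by blast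
      have "exp t / fact 3 * x ^ 3 \<le> 0"
        using x by (intro mult_nonneg_nonpos) (auto simp: power_le_zero_eq)
      then show ?thesis using t(2) by (simp add: numeral_eq_Suc fact_numeral)
    qed simp
    then have "p * exp x \<le> p * (1 + x + x\<^sup>2 / 2)" using p by (intro mult_left_mono)
    then have "p * exp x - p \<le> p * (x + x\<^sup>2 / 2)" by (simp add: algebra_simps)
    moreover have "0 < 1 - p + p * exp x" using p by (intro add_pos_nonneg) auto
    ultimately show ?thesis using ln_le_minus_one[of "1 - p + p * exp x"] by linarith
  qed
  define p where "p = exp d / (1 + exp d)"
  have e: "1 + exp d > 0" by (simp add: add_pos_pos)
  have p: "0 < p" "p < 1" using e by (simp_all add: p_def)
  have pos: "1 - p + p * exp x > 0" using p by (simp add: add_pos_pos)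
  have "(1 + exp d) * p = exp d" using e by (simp add: p_def)
  moreover have "(1 + exp d) * (1 - p + p * exp x) = (1 + exp d) - (1 + exp d) * p + ((1 + exp d) * p) * exp x"
    by (simp add: algebra_simps)
  ultimately have "1 + exp (d + x) = (1 + exp d) * (1 - p + p * exp x)"
    by (simp add: exp_add)
  then have ln: "ln (1 + exp (d + x)) = ln (1 + exp d) + ln (1 - p + p * exp x)"
    using pos e by (simp add: ln_mult)
  have "ln (1 - p + p * exp x) \<le> p * x + x\<^sup>2 / 2"
  proof (cases "x \<le> 0")
    case True
    have "p * x\<^sup>2 \<le> 1 * x\<^sup>2" using p by (intro mult_right_mono) auto
    then show ?thesis using half[OF True, of p] p by (simp add: algebra_simps)
  next
    case False
    have pos': "1 - (1 - p) + (1 - p) * exp (- x) > 0" using p by (simp add: add_pos_pos)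
    \<comment> \<open>Positive x is reduced to \<open>half\<close> by exchanging the two outcomes,
      that is, p with 1 - p and x with -x.\<close>
    have "1 - p + p * exp x = exp x * (1 - (1 - p) + (1 - p) * exp (- x))"
      by (simp add: algebra_simps exp_minus)
    then have "ln (1 - p + p * exp x) = x + ln (1 - (1 - p) + (1 - p) * exp (- x))"
      using pos' by (simp add: ln_mult)
    also have "\<dots> \<le> x + (1 - p) * (- x + x\<^sup>2 / 2)"
      using half[of "- x" "1 - p"] False p by simp
    also have "\<dots> \<le> p * x + x\<^sup>2 / 2"
      using p by (simp add: algebra_simps)
    finally show ?thesis .
  qed
  then show ?thesis using ln by (simp add: p_def)
qed

lemma pref_exp_diff: "pref y x = exp (y - x) / (1 + exp (y - x))"
  by (simp add: pref_def exp_diff divide_simps add_pos_pos)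

text \<open>The potential is \<open>ln (1 + exp (w v - w u))\<close>: it starts at \<open>ln 2\<close>, stays nonnegative, and its
  derivative in \<open>w v - w u\<close> is the probability of ranking \<open>v\<close> before \<open>u\<close>.\<close>

lemma hedge_pair:
  fixes s :: "nat \<Rightarrow> 'a \<Rightarrow> real"
  assumes "\<eta> > 0"
  shows "(\<Sum>t = 1..T. - pref (weight \<eta> s (t - 1) v) (weight \<eta> s (t - 1) u) * (s t v - s t u))
    \<le> ln 2 / \<eta> + \<eta> / 2 * (\<Sum>t = 1..T. (s t v - s t u)\<^sup>2)"
proof -
  let ?D = "\<lambda>t. weight \<eta> s t v - weight \<eta> s t u"
  \<comment> \<open>Multiplied by \<eta> and with the final potential on the left, the claim is
    inductive: the linear growth of the potential cancels the new summand, and only the quadratic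
    term remains.\<close>
  have "\<eta> * (\<Sum>t = 1..T. - pref (weight \<eta> s (t - 1) v) (weight \<eta> s (t - 1) u) * (s t v - s t u))
     + ln (1 + exp (?D T)) \<le> ln 2 + \<eta>\<^sup>2 / 2 * (\<Sum>t = 1..T. (s t v - s t u)\<^sup>2)"
  proof (induction T)
    case (Suc T)
    define d where "d = s (Suc T) v - s (Suc T) u"
    have D: "?D (Suc T) = ?D T + \<eta> * d" by (simp add: d_def algebra_simps)
    have "ln (1 + exp (?D (Suc T))) \<le> ln (1 + exp (?D T))
        + pref (weight \<eta> s T v) (weight \<eta> s T u) * (\<eta> * d) + (\<eta> * d)\<^sup>2 / 2"
      unfolding pref_exp_diff D using softplus_le[of "?D T" "\<eta> * d"] by simp
    then show ?case
      using Suc unfolding sum.cl_ivl_Suc d_def[symmetric]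
      by (simp add: algebra_simps power_mult_distrib)
  qed simp
  moreover have "ln (1 + exp (?D T)) \<ge> 0" by simp
  ultimately have "\<eta> * (\<Sum>t = 1..T. - pref (weight \<eta> s (t - 1) v) (weight \<eta> s (t - 1) u) * (s t v - s t u))
     \<le> ln 2 + \<eta>\<^sup>2 / 2 * (\<Sum>t = 1..T. (s t v - s t u)\<^sup>2)" by linarith
  also have "\<dots> = \<eta> * (ln 2 / \<eta> + \<eta> / 2 * (\<Sum>t = 1..T. (s t v - s t u)\<^sup>2))"
    using assms by (simp add: algebra_simps power2_eq_square)
  finally show ?thesis using assms by simp
qed

text \<open>An injective \<pi> selects one orientation of every unordered pair. Taken from the
  comparator, the orientation says which of the two experts of the pair it follows.\<close>

lemma sum_ordered_pairs:
  fixes f :: "'a \<Rightarrow> 'a \<Rightarrow> real" and \<pi> :: "'a \<Rightarrow> nat"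
  assumes "finite V" "inj_on \<pi> V"
  shows "(\<Sum>(u, v) \<in> {(u, v) \<in> V \<times> V. u \<noteq> v}. f u v) =
    (\<Sum>(u, v) \<in> {(u, v) \<in> V \<times> V. \<pi> u < \<pi> v}. f u v + f v u)"
proof -
  let ?A = "{(u, v) \<in> V \<times> V. \<pi> u < \<pi> v}" and ?B = "{(u, v) \<in> V \<times> V. \<pi> v < \<pi> u}"
  have split: "{(u, v) \<in> V \<times> V. u \<noteq> v} = ?A \<union> ?B"
    using inj_onD[OF assms(2)] by (force simp: not_less_iff_gr_or_eq)
  have fin: "finite ?A" "finite ?B"
    using assms(1) by (auto intro: finite_subset[of _ "V \<times> V"])
  have "(\<Sum>(u, v) \<in> ?B. f u v) = (\<Sum>(u, v) \<in> ?A. f v u)"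
    by (rule sum.reindex_bij_witness[of _ prod.swap prod.swap]) auto
  then show ?thesis unfolding split using fin
    by (subst sum.union_disjoint) (auto simp: sum.distrib case_prod_unfold)
qed

lemma pair_variation_eq:
  assumes "finite V" "inj_on (\<pi> :: 'a \<Rightarrow> nat) V"
  shows "pair_variation V s = (\<Sum>(u, v) \<in> {(u, v) \<in> V \<times> V. \<pi> u < \<pi> v}. (s v - s u)\<^sup>2)"
proof -
  have "(\<Sum>u\<in>V. \<Sum>v\<in>V. (s v - s u)\<^sup>2) = (\<Sum>(u, v) \<in> {(u, v) \<in> V \<times> V. u \<noteq> v}. (s v - s u)\<^sup>2)"
    unfolding sum.cartesian_product using assms(1) by (intro sum.mono_neutral_right) auto
  also have "\<dots> = 2 * (\<Sum>(u, v) \<in> {(u, v) \<in> V \<times> V. \<pi> u < \<pi> v}. (s v - s u)\<^sup>2)"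
    unfolding sum_ordered_pairs[OF assms] sum_distrib_left
    by (intro sum.cong) (auto simp: power2_commute)
  finally show ?thesis by (simp add: pair_variation_def)
qed

lemma card_ordered_pairs:
  assumes "finite V" "inj_on (\<pi> :: 'a \<Rightarrow> nat) V"
  shows "real (card {(u, v) \<in> V \<times> V. \<pi> u < \<pi> v}) \<le> (real (card V))\<^sup>2 / 2"
proof -
  have "2 * real (card {(u, v) \<in> V \<times> V. \<pi> u < \<pi> v}) = real (card {(u, v) \<in> V \<times> V. u \<noteq> v})"
    using sum_ordered_pairs[OF assms, of "\<lambda>_ _. 1"] by simp
  also have "\<dots> \<le> real (card (V \<times> V))"
    using assms(1) by (intro of_nat_mono card_mono) auto
  finally show ?thesis by (simp add: card_cartesian_product power2_eq_square)
qed

lemma regret_bound: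
  fixes V :: "'a set"
  assumes "finite V" "inj_on \<pi> V" "\<eta> > 0"
    and "\<And>t. t \<in> {1..T} \<Longrightarrow> pair_variation V (s t) \<le> M"
  shows "measure_pmf.expectation (online_rank sp V \<eta> s T) (total_loss V s T)
    \<le> total_loss V s T (\<lambda>_. \<pi>) + (real (card V))\<^sup>2 * ln 2 / (2 * \<eta>) + \<eta> / 2 * (real T * M)"
proof -
  let ?P = "{(u, v) \<in> V \<times> V. u \<noteq> v}" and ?A = "{(u, v) \<in> V \<times> V. \<pi> u < \<pi> v}"
  let ?q = "\<lambda>t u v. pref (weight \<eta> s (t - 1) u) (weight \<eta> s (t - 1) v)"
  have "measure_pmf.expectation (online_rank sp V \<eta> s T) (total_loss V s T) - total_loss V s T (\<lambda>_. \<pi>)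
    = (\<Sum>t = 1..T. \<Sum>(u, v)\<in>?P. (?q t u v - of_bool (\<pi> u < \<pi> v)) * max (s t v - s t u) 0)"
    unfolding expectation_total_loss[OF assms(1)] expectation_pair_loss[OF assms(1)]
    unfolding total_loss_def pair_loss_def
    by (simp add: sum_subtractf case_prod_unfold algebra_simps)
  \<comment> \<open>If \<pi> puts \<open>u\<close> before \<open>v\<close>, both ordered summands
    carry the same factor up to sign, since q(u,v) - 1 = - q(v,u). The positive parts of d and -d
    thus combine to d itself, which makes the regret of a pair linear in the feedback.\<close>
  also have "\<dots> = (\<Sum>t = 1..T. \<Sum>(u, v)\<in>?A. - ?q t v u * (s t v - s t u))"
  proof (rule sum.cong[OF refl], subst sum_ordered_pairs[OF assms(1,2)], rule sum.cong[OF refl], clarify)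
    fix t u v assume "\<pi> u < \<pi> v"
    then show "(?q t u v - of_bool (\<pi> u < \<pi> v)) * max (s t v - s t u) 0
      + (?q t v u - of_bool (\<pi> v < \<pi> u)) * max (s t u - s t v) 0 = - ?q t v u * (s t v - s t u)"
      unfolding pref_commute[of "weight \<eta> s (t - 1) u" "weight \<eta> s (t - 1) v"]
      by (simp add: max_def algebra_simps)
  qed
  \<comment> \<open>With the sum over time innermost, each pair is a separate two-expert
    problem.\<close>
  also have "\<dots> = (\<Sum>(u, v)\<in>?A. \<Sum>t = 1..T. - ?q t v u * (s t v - s t u))"
    by (subst sum.swap) (simp add: case_prod_unfold)
  also have "\<dots> \<le> (\<Sum>(u, v)\<in>?A. ln 2 / \<eta> + \<eta> / 2 * (\<Sum>t = 1..T. (s t v - s t u)\<^sup>2))"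
    using hedge_pair[OF assms(3)] by (intro sum_mono) (simp add: case_prod_unfold)
  also have "\<dots> = real (card ?A) * (ln 2 / \<eta>) + \<eta> / 2 * (\<Sum>t = 1..T. pair_variation V (s t))"
    unfolding pair_variation_eq[OF assms(1,2)] case_prod_unfold
    by (subst sum.swap) (simp add: sum.distrib sum_distrib_left)
  also have "\<dots> \<le> (real (card V))\<^sup>2 / 2 * (ln 2 / \<eta>) + \<eta> / 2 * (\<Sum>t = 1..T. M)"
    using assms card_ordered_pairs[OF assms(1,2)]
    by (intro add_mono mult_right_mono mult_left_mono sum_mono) auto
  finally show ?thesis by (simp add: algebra_simps)
qed

lemma learning_rate_le_1:
  fixes n T :: nat and M :: real
  assumes "M > 0" "real T \<ge> (real n)\<^sup>2 / M * ln 2"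
  shows "real n * sqrt (ln 2) / sqrt (real T * M) \<le> 1"
\<comment> \<open>For \<open>T = 0\<close> the quotient is 0 by the convention on division by
  zero.\<close>
proof (cases "T = 0")
  case False
  have "(real n)\<^sup>2 * ln 2 \<le> real T * M" using assms by (simp add: field_simps)
  then have "sqrt ((real n)\<^sup>2 * ln 2) \<le> sqrt (real T * M)" by simp
  then show ?thesis using False assms(1) by (simp add: real_sqrt_mult divide_le_eq)
qed simp

lemma regret_bound_tuned:
  fixes V :: "'a set" and n T :: nat
  assumes V: "finite V" "n = card V" and \<pi>: "inj_on \<pi> V" and M: "M > 0"
    and var: "\<And>t. t \<in> {1..T} \<Longrightarrow> pair_variation V (s t) \<le> M"
    and T: "real T \<ge> (real n)\<^sup>2 / M * ln 2"
    and \<eta>: "\<eta> = real n * sqrt (ln 2) / sqrt (real T * M)"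
  shows "measure_pmf.expectation (online_rank sp V \<eta> s T) (total_loss V s T)
    \<le> total_loss V s T (\<lambda>_. \<pi>) + real n * sqrt (real T * M * ln 2)"
\<comment> \<open>Without items \<eta> is 0 and the untuned bound does not apply. With items, the
  lower bound on \<open>T\<close> forces \<open>T\<close> to be positive.\<close>
proof (cases "n = 0")
  case True
  then have "V = {}" using V by auto
  then have "total_loss V s T = (\<lambda>_. 0)" by (auto simp: total_loss_def pair_loss_def)
  then show ?thesis using True by simp
next
  case False
  have "(real n)\<^sup>2 / M * ln 2 > 0" using False M by simp
  then have "real T > 0" using T by linarith
  then have TM: "real T * M > 0" using M by simp
  \<comment> \<open>In these terms \<eta> = n b / a, and both error terms equal n a b / 2.\<close>
  define a b where "a = sqrt (real T * M)" and "b = sqrt (ln 2 :: real)"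
  have ab: "a > 0" "b > 0" "real T * M = a\<^sup>2" "ln 2 = b\<^sup>2" using TM by (simp_all add: a_def b_def)
  have \<eta>': "\<eta> = real n * b / a" by (simp add: \<eta> a_def b_def)
  have "sqrt (real T * M * ln 2) = a * b" by (simp add: a_def b_def real_sqrt_mult)
  moreover have "(real n)\<^sup>2 * ln 2 / (2 * \<eta>) + \<eta> / 2 * (real T * M) = real n * (a * b)"
    unfolding ab(3,4) \<eta>' using ab(1,2) False by (simp add: field_simps power2_eq_square)
  moreover have "\<eta> > 0" using ab False by (simp add: \<eta>')
  ultimately show ?thesis using regret_bound[OF V(1) \<pi>, of \<eta> T s M sp] var V(2) by simp
qed

section \<open>QuickSort implementation\<close>

text \<open>The list program tosses its coins one after another. As the items are distinct, tossing
  the coin of the head amounts to inserting a new coordinate into the product distribution, which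
  leaves the split of the tail unchanged.\<close>

lemma partition_impl_outcome:
  assumes "distinct vs"
  shows "map_pmf fst (partition_impl y (map (\<lambda>v. (v, w v)) vs)) =
    map_pmf (\<lambda>left. (map (\<lambda>v. (v, w v)) (filter left vs), map (\<lambda>v. (v, w v)) (filter (\<lambda>v. \<not> left v) vs)))
      (Pi_pmf (set vs) False (\<lambda>v. bernoulli_pmf (pref (w v) y)))"
  using assms
proof (induction vs)
  case (Cons a vs)
  let ?g = "\<lambda>v. (v, w v)"
  let ?split = "\<lambda>left vs. (map ?g (filter left vs), map ?g (filter (\<lambda>v. \<not> left v) vs))"
  let ?add = "\<lambda>l z. if l then (?g a # fst z, snd z) else (fst z, ?g a # snd z)"
  let ?B = "bernoulli_pmf (pref (w a) y)" and ?P = "Pi_pmf (set vs) False (\<lambda>v. bernoulli_pmf (pref (w v) y))"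
  have upd: "?split (f(a := l)) (a # vs) = ?add l (?split f vs)" for f l
  proof -
    have "(f(a := l)) v = f v" if "v \<in> set vs" for v using that Cons.prems by auto
    then have "filter (f(a := l)) vs = filter f vs" "filter (\<lambda>v. \<not> (f(a := l)) v) vs = filter (\<lambda>v. \<not> f v) vs"
      by (simp_all del: fun_upd_apply cong: filter_cong)
    then show ?thesis by (cases l) (simp_all del: fun_upd_apply add: fun_upd_same)
  qed
  have "map_pmf fst (partition_impl y (map ?g (a # vs))) =
      ?B \<bind> (\<lambda>l. map_pmf fst (partition_impl y (map ?g vs)) \<bind> (\<lambda>z. return_pmf (?add l z)))"
    by (simp add: map_bind_pmf bind_map_pmf case_prod_unfold)
  also have "\<dots> = ?B \<bind> (\<lambda>l. ?P \<bind> (\<lambda>f. return_pmf (?split (f(a := l)) (a # vs))))"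
    unfolding upd using Cons by (simp add: bind_map_pmf)
  also have "\<dots> = map_pmf (\<lambda>f. ?split f (a # vs)) (Pi_pmf (set (a # vs)) False (\<lambda>v. bernoulli_pmf (pref (w v) y)))"
    using Cons.prems by (simp add: Pi_pmf_insert' map_bind_pmf del: filter.simps)
  finally show ?case .
qed simp

lemma set_remove_nth:
  assumes "distinct xs" "i < length xs"
  shows "set (take i xs @ drop (Suc i) xs) = set xs - {xs ! i}" "distinct (take i xs @ drop (Suc i) xs)"
proof -
  have "xs = take i xs @ xs ! i # drop (Suc i) xs" using assms by (simp add: id_take_nth_drop)
  then have "distinct (take i xs @ xs ! i # drop (Suc i) xs)"
    "set xs = set (take i xs @ xs ! i # drop (Suc i) xs)" using assms by metis+
  then show "set (take i xs @ drop (Suc i) xs) = set xs - {xs ! i}" "distinct (take i xs @ drop (Suc i) xs)"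
    by auto
qed

text \<open>A uniform index into a list without repetitions is a uniform element of its set. The
  projection to results is pushed through every bind, so that the induction hypothesis can replace
  the recursive calls.\<close>

lemma quicksort_impl_outcome:
  "distinct vs \<Longrightarrow> map_pmf fst (quicksort_impl (map (\<lambda>v. (v, w v)) vs)) = quicksort w (set vs)"
proof (induction vs rule: length_induct)
  case (1 vs)
  show ?case
  proof (cases "vs = []")
    case True
    then show ?thesis by (simp add: quicksort.simps[of w "{}"] quicksort_impl.simps[of "[]"])
  next
    case False
    let ?g = "\<lambda>v. (v, w v)"
    let ?rest = "\<lambda>i. take i vs @ drop (Suc i) vs"
    let ?next = "\<lambda>i z. map_pmf fst (quicksort_impl (fst z)) \<bind>
      (\<lambda>ys. map_pmf fst (quicksort_impl (snd z)) \<bind> (\<lambda>zs. return_pmf (ys @ vs ! i # zs)))"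
    let ?body = "\<lambda>p. Pi_pmf (set vs - {p}) False (\<lambda>v. bernoulli_pmf (pref (w v) (w p))) \<bind>
      (\<lambda>left. quicksort w {v \<in> set vs - {p}. left v} \<bind>
         (\<lambda>xs. quicksort w {v \<in> set vs - {p}. \<not> left v} \<bind> (\<lambda>ys. return_pmf (xs @ p # ys))))"
    have "map_pmf fst (quicksort_impl (map ?g vs)) = pmf_of_set {..<length vs} \<bind>
      (\<lambda>i. map_pmf fst (partition_impl (snd (map ?g vs ! i)) (take i (map ?g vs) @ drop (Suc i) (map ?g vs))) \<bind>
         (\<lambda>z. map_pmf fst (quicksort_impl (fst z)) \<bind>
           (\<lambda>ys. map_pmf fst (quicksort_impl (snd z)) \<bind> (\<lambda>zs. return_pmf (ys @ fst (map ?g vs ! i) # zs)))))"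
      using False
      by (subst quicksort_impl.simps) (simp add: map_bind_pmf bind_map_pmf case_prod_unfold del: map_append)
    also have "\<dots> = pmf_of_set {..<length vs} \<bind> (\<lambda>i. ?body (vs ! i))"
    proof (intro bind_pmf_cong refl)
      fix i assume "i \<in> set_pmf (pmf_of_set {..<length vs})"
      then have i: "i < length vs" using False by (simp add: lessThan_empty_iff)
      note rest = set_remove_nth[OF 1(2) i]
      \<comment> \<open>Stated for an arbitrary predicate, this serves both parts of the
        split.\<close>
      have qs: "map_pmf fst (quicksort_impl (map ?g (filter P (?rest i)))) =
          quicksort w {v \<in> set vs - {vs ! i}. P v}" for P
      proof -
        have "length (filter P (?rest i)) < length vs"
          by (rule le_less_trans[OF length_filter_le]) (use i in simp)
        moreover have "set (filter P (?rest i)) = {v \<in> set vs - {vs ! i}. P v}"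
          using rest(1) by auto
        ultimately show ?thesis using 1(1) rest(2) distinct_filter by metis
      qed
      have "map_pmf fst (partition_impl (snd (map ?g vs ! i)) (take i (map ?g vs) @ drop (Suc i) (map ?g vs))) =
        map_pmf fst (partition_impl (w (vs ! i)) (map ?g (?rest i)))"
        using i by (simp add: take_map drop_map)
      then show "map_pmf fst (partition_impl (snd (map ?g vs ! i)) (take i (map ?g vs) @ drop (Suc i) (map ?g vs))) \<bind>
         (\<lambda>z. map_pmf fst (quicksort_impl (fst z)) \<bind>
           (\<lambda>ys. map_pmf fst (quicksort_impl (snd z)) \<bind> (\<lambda>zs. return_pmf (ys @ fst (map ?g vs ! i) # zs))))
         = ?body (vs ! i)"
        unfolding partition_impl_outcome[OF rest(2)] rest(1)
        using i by (simp add: bind_map_pmf[of "\<lambda>left. (_ left, _ left)"] qs del: filter_append map_append)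
    qed
    also have "\<dots> = map_pmf ((!) vs) (pmf_of_set {..<length vs}) \<bind> ?body"
      by (simp add: bind_map_pmf)
    also have "map_pmf ((!) vs) (pmf_of_set {..<length vs}) = pmf_of_set (set vs)"
      using 1(2) False
      by (subst map_pmf_of_set_inj)
         (auto simp: lessThan_empty_iff inj_on_nth set_conv_nth intro!: arg_cong[of _ _ pmf_of_set])
    also have "pmf_of_set (set vs) \<bind> ?body = quicksort w (set vs)"
      using False by (subst quicksort.simps[of w "set vs"]) simp
    finally show ?thesis .
  qed
qed

section \<open>Expected number of steps of QuickSort\<close>

lemma finite_set_partition_impl: "finite (set_pmf (partition_impl y xs))"
  by (induction xs) (auto simp: finite_set_pmf_bool split: prod.splits)

lemma partition_impl_cost: "z \<in> set_pmf (partition_impl y xs) \<Longrightarrow> snd z = length xs + 1"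
  by (induction xs arbitrary: z) (auto split: prod.splits)

lemma length_partition_impl':
  "z \<in> set_pmf (partition_impl y xs) \<Longrightarrow> length (fst (fst z)) + length (snd (fst z)) = length xs"
  by (metis length_partition_impl prod.collapse)

lemma finite_set_quicksort_impl: "finite (set_pmf (quicksort_impl xs))"
proof (induction xs rule: length_induct)
  case (1 xs)
  show ?case
  proof (cases "xs = []")
    case False
    then have "finite (set_pmf (pmf_of_set {..<length xs}))" by (simp add: lessThan_empty_iff)
    with False show ?thesis
      by (subst quicksort_impl.simps)
         (auto simp: lessThan_empty_iff finite_set_partition_impl case_prod_unfold
            intro!: finite_UN_I 1[rule_format] dest!: length_partition_impl')
  qed (simp add: quicksort_impl.simps)
qed

text \<open>Needed for the cost of appending the sorted parts.\<close>

lemma length_quicksort_impl: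
  "z \<in> set_pmf (quicksort_impl xs) \<Longrightarrow> length (fst z) = length xs"
proof (induction xs arbitrary: z rule: length_induct)
  case (1 xs)
  show ?case
  proof (cases "xs = []")
    case True
    then show ?thesis using 1(2) by (simp add: quicksort_impl.simps)
  next
    case False
    from 1(2) False obtain i ls rs c ys cl zs cr where *: "i < length xs"
      "((ls, rs), c) \<in> set_pmf (partition_impl (snd (xs ! i)) (take i xs @ drop (Suc i) xs))"
      "(ys, cl) \<in> set_pmf (quicksort_impl ls)" "(zs, cr) \<in> set_pmf (quicksort_impl rs)"
      "fst z = ys @ fst (xs ! i) # zs"
      by (subst (asm) quicksort_impl.simps) (auto simp: lessThan_empty_iff split: prod.splits)
    have len: "length ls + length rs = length xs - 1"
      using length_partition_impl[OF *(2)] *(1) by simp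
    have "length ys = length ls" "length zs = length rs"
      using 1(1)[rule_format, of ls "(ys, cl)"] 1(1)[rule_format, of rs "(zs, cr)"] *(1,3,4) len by auto
    then show ?thesis using *(1,5) len by simp
  qed
qed

text \<open>Different entries fall independently, while no entry falls on both sides; so the mean of
  the product of the sizes is the product of the means without its diagonal, which is
  \<open>C\<close>.\<close>

lemma expectation_partition_impl:
  fixes y :: real and xs :: "('a \<times> real) list"
  defines "A \<equiv> (\<Sum>x\<leftarrow>xs. pref (snd x) y)" and "B \<equiv> (\<Sum>x\<leftarrow>xs. pref y (snd x))"
    and "C \<equiv> (\<Sum>x\<leftarrow>xs. pref (snd x) y * pref y (snd x))"
  shows "measure_pmf.expectation (partition_impl y xs) (\<lambda>z. real (length (fst (fst z)))) = A"
    and "measure_pmf.expectation (partition_impl y xs) (\<lambda>z. real (length (snd (fst z)))) = B"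
    and "measure_pmf.expectation (partition_impl y xs)
      (\<lambda>z. real (length (fst (fst z))) * real (length (snd (fst z)))) = A * B - C"
proof -
  let ?E = "\<lambda>xs. measure_pmf.expectation (partition_impl y xs)"
  let ?l = "\<lambda>z :: (('a \<times> real) list \<times> ('a \<times> real) list) \<times> nat. real (length (fst (fst z)))"
  let ?r = "\<lambda>z :: (('a \<times> real) list \<times> ('a \<times> real) list) \<times> nat. real (length (snd (fst z)))"
  have int: "integrable (measure_pmf (partition_impl y xs)) f" for xs and f :: "_ \<Rightarrow> real"
    by (rule integrable_measure_pmf_finite[OF finite_set_partition_impl])
  have step: "?E (a # xs) h =
      pref (snd a) y * ?E xs (\<lambda>z. h ((a # fst (fst z), snd (fst z)), snd z + 1))
      + pref y (snd a) * ?E xs (\<lambda>z. h ((fst (fst z), a # snd (fst z)), snd z + 1))"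
    for a xs and h :: "_ \<Rightarrow> real"
    by (simp add: expectation_bind finite_set_pmf_bool finite_set_partition_impl case_prod_unfold
        pref_bounds pref_commute[of "snd a" y] algebra_simps)
  \<comment> \<open>The three means are proved together, because enlarging one part changes the
    product by the size of the other.\<close>
  have "?E xs ?l = (\<Sum>x\<leftarrow>xs. pref (snd x) y) \<and> ?E xs ?r = (\<Sum>x\<leftarrow>xs. pref y (snd x)) \<and>
    ?E xs (\<lambda>z. ?l z * ?r z) = (\<Sum>x\<leftarrow>xs. pref (snd x) y) * (\<Sum>x\<leftarrow>xs. pref y (snd x))
      - (\<Sum>x\<leftarrow>xs. pref (snd x) y * pref y (snd x))"
  proof (induction xs)
    case (Cons a xs)
    then show ?case
      using pref_commute[of "snd a" y]
      unfolding step by (simp add: int distrib_right distrib_left) (simp add: algebra_simps)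
  qed simp
  then show "?E xs ?l = A" "?E xs ?r = B" "?E xs (\<lambda>z. ?l z * ?r z) = A * B - C"
    by (simp_all add: A_def B_def C_def)
qed

text \<open>A tournament on three players contains a directed path of length two; this is the
  randomised version, in which \<open>q i j\<close> is the probability of the edge from \<open>i\<close> to \<open>j\<close>.\<close>

lemma sum_paths_ge:
  fixes q :: "'a \<Rightarrow> 'a \<Rightarrow> real"
  assumes "finite I" "\<And>i j. 0 \<le> q i j" "\<And>i j. q j i = 1 - q i j"
  shows "(\<Sum>p\<in>I. (\<Sum>i\<in>I. q i p) * (\<Sum>j\<in>I. q p j)) \<ge> real (card I) ^ 3 / 6"
proof -
  define F where "F a b c = q a b * q b c" for a b c
  let ?S = "\<lambda>G :: 'a \<Rightarrow> 'a \<Rightarrow> 'a \<Rightarrow> real. \<Sum>a\<in>I. \<Sum>b\<in>I. \<Sum>c\<in>I. G a b c"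
  have swap1: "?S G = ?S (\<lambda>a b c. G b a c)" for G
    by (rule sum.swap)
  have swap2: "?S G = ?S (\<lambda>a b c. G a c b)" for G
    by (intro sum.cong refl sum.swap)
  have eqs: "?S F = ?S (\<lambda>a b c. F b a c)" "?S F = ?S (\<lambda>a b c. F a c b)"
    "?S F = ?S (\<lambda>a b c. F c a b)" "?S F = ?S (\<lambda>a b c. F b c a)" "?S F = ?S (\<lambda>a b c. F c b a)"
    using swap1[of F] swap2[of F] trans[OF swap1[of F] swap2]
      trans[OF swap2[of F] swap1] trans[OF trans[OF swap1[of F] swap2] swap1] by simp_all
  have six: "1 \<le> F a b c + F b a c + F a c b + F c a b + F b c a + F c b a" for a b c
  proof -
    define x y z where "x = q a b" and "y = q b c" and "z = q c a"
    have flip: "q b a = 1 - x" "q c b = 1 - y" "q a c = 1 - z"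
      unfolding x_def y_def z_def by (rule assms(3))+
    \<comment> \<open>This is the expected number of directed paths through all three players: one
      in a transitive tournament, three in a cyclic one, so 1 plus twice the probability of a cycle.
      The identity also covers coinciding indices, where \<open>q\<close> is 1/2.\<close>
    have "F a b c + F b a c + F a c b + F c a b + F b c a + F c b a =
        1 + 2 * ((1 - x) * (1 - y) * (1 - z) + x * y * z)"
      unfolding F_def flip x_def[symmetric] y_def[symmetric] z_def[symmetric] by (simp add: algebra_simps)
    moreover have "0 \<le> x" "0 \<le> y" "0 \<le> z" "0 \<le> 1 - x" "0 \<le> 1 - y" "0 \<le> 1 - z"
      unfolding x_def y_def z_def assms(3)[symmetric] by (rule assms(2))+
    ultimately show ?thesis by (simp add: mult_nonneg_nonneg)
  qed
  have "real (card I) ^ 3 = ?S (\<lambda>_ _ _. 1)"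
    by (simp add: power3_eq_cube)
  also have "\<dots> \<le> ?S (\<lambda>a b c. F a b c + F b a c + F a c b + F c a b + F b c a + F c b a)"
    by (intro sum_mono six)
  also have "\<dots> = 6 * ?S F"
    unfolding sum.distrib using eqs by linarith
  \<comment> \<open>The middle vertex of the path plays the pivot.\<close>
  also have "?S F = (\<Sum>p\<in>I. (\<Sum>i\<in>I. q i p) * (\<Sum>j\<in>I. q p j))"
    unfolding swap1[of F] by (simp add: F_def sum_product)
  finally show ?thesis by simp
qed

text \<open>The factor 21 makes the average gain 42 / n * n^2 / 6 equal to the linear cost 7 n. The
  linear term loses 20 with each pivot, which absorbs the lower-order corrections and the second
  copy of the constant; the 1 is the cost of the call on the empty list.\<close>

definition quicksort_bound :: "nat \<Rightarrow> real" where
  "quicksort_bound n = 21 * (real n * ln (real n)) + 20 * real n + 1"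

text \<open>The gain is \<open>x ln (n / x) \<ge> x (1 - x / n)\<close> for \<open>x = l\<close> and \<open>x = r\<close>, so a lower bound on the
  expected value of \<open>l * r\<close> suffices.\<close>

lemma quicksort_bound_split:
  assumes "l + r + 1 = n"
  shows "quicksort_bound l + quicksort_bound r \<le>
    quicksort_bound n - 21 * (2 * (real l * real r) + real n - 1) / real n - 19"
proof -
  have n: "real n > 0" "real n = real l + real r + 1" using assms by auto
  have xlnx: "real k * ln (real k) \<le> real k * ln (real n) - real k * (real n - real k) / real n" for k
  proof (cases "k = 0")
    case False
    then have "ln (real k / real n) \<le> real k / real n - 1" using n by (intro ln_le_minus_one) auto
    then have "ln (real k) \<le> ln (real n) + (real k / real n - 1)" using False n by (simp add: ln_div)
    then have "real k * ln (real k) \<le> real k * (ln (real n) + (real k / real n - 1))"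
      by (intro mult_left_mono) auto
    then show ?thesis using n(1) by (simp add: field_simps)
  qed simp
  \<comment> \<open>Here n - l = r + 1 and n - r = l + 1.\<close>
  have "real l * (real n - real l) + real r * (real n - real r) = 2 * (real l * real r) + real n - 1"
    using n(2) by (simp add: algebra_simps)
  then have "real l * (real n - real l) / real n + real r * (real n - real r) / real n =
      (2 * (real l * real r) + real n - 1) / real n"
    by (simp add: add_divide_distrib[symmetric])
  moreover have "real l * ln (real n) + real r * ln (real n) \<le> real n * ln (real n)"
    using n by (simp add: distrib_right)
  ultimately have "real l * ln (real l) + real r * ln (real r) \<le>
      real n * ln (real n) - (2 * (real l * real r) + real n - 1) / real n"
    using xlnx[of l] xlnx[of r] by linarith
  then show ?thesis
    unfolding quicksort_bound_def times_divide_eq_right[symmetric] using n(2) by linarith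
qed

lemma sum_list_remove_nth:
  fixes f :: "'a \<Rightarrow> real"
  assumes "i < length xs"
  shows "(\<Sum>x\<leftarrow>take i xs @ drop (Suc i) xs. f x) = (\<Sum>j<length xs. f (xs ! j)) - f (xs ! i)"
proof -
  have "(\<Sum>j<length xs. f (xs ! j)) = (\<Sum>x\<leftarrow>xs. f x)"
    by (simp add: sum_list_sum_nth atLeast0LessThan)
  also have "\<dots> = (\<Sum>x\<leftarrow>take i xs @ xs ! i # drop (Suc i) xs. f x)"
    using assms by (simp add: id_take_nth_drop[symmetric] del: map_append sum_list_append)
  finally show ?thesis by simp
qed

text \<open>The bound for a fixed pivot keeps the product \<open>A i * B i\<close> of the sums of
  preferences; only its average over the pivot is known to be large, by
  \<open>sum_paths_ge\<close>.\<close>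

lemma expectation_quicksort_impl:
  "measure_pmf.expectation (quicksort_impl xs) (\<lambda>z. real (snd z)) \<le> quicksort_bound (length xs)"
proof (induction xs rule: length_induct)
  case (1 xs)
  show ?case
  proof (cases "xs = []")
    case True
    then show ?thesis by (simp add: quicksort_impl.simps quicksort_bound_def)
  next
    case False
    let ?E = "measure_pmf.expectation"
    define n where "n = length xs"
    have n: "n > 0" using False by (simp add: n_def)
    let ?part = "\<lambda>i. partition_impl (snd (xs ! i)) (take i xs @ drop (Suc i) xs)"
    define cost where "cost i z y z' = T_length xs + T_nth xs i + T_take i xs + T_drop (Suc i) xs
            + T_append (take i xs) (drop (Suc i) xs)
            + snd z + snd y + snd z' + T_append (fst y) (fst (xs ! i) # fst z') + 1"
      for i and z :: "(('a \<times> real) list \<times> ('a \<times> real) list) \<times> nat" and y z' :: "'a list \<times> nat"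
    define q where "q i j = pref (snd (xs ! i)) (snd (xs ! j))" for i j
    define A where "A i = (\<Sum>j<n. q j i)" for i
    define B where "B i = (\<Sum>j<n. q i j)" for i
    note fin = finite_set_partition_impl finite_set_quicksort_impl
    have int: "integrable (measure_pmf (?part i)) f" "integrable (measure_pmf (quicksort_impl ys)) g"
      for i ys and f :: "_ \<Rightarrow> real" and g :: "_ \<Rightarrow> real"
      by (intro integrable_measure_pmf_finite fin)+
    have q: "q j i = 1 - q i j" "0 \<le> q i j" "q i i = 1 / 2" for i j
      using pref_commute[of "snd (xs ! i)" "snd (xs ! j)"] pref_commute[of "snd (xs ! i)" "snd (xs ! i)"]
      by (auto simp: q_def pref_bounds)
    have E: "?E (quicksort_impl xs) (\<lambda>z. real (snd z)) = ?E (pmf_of_set {..<n}) (\<lambda>i. ?E (?part i)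
        (\<lambda>z. ?E (quicksort_impl (fst (fst z))) (\<lambda>y. ?E (quicksort_impl (snd (fst z)))
          (\<lambda>z'. real (cost i z y z')))))"
      using n unfolding n_def
      by (subst quicksort_impl.simps)
         (simp add: expectation_bind fin case_prod_unfold lessThan_empty_iff cost_def del: of_nat_add)
    \<comment> \<open>The constant is 3 - 21 - 19 = -37, from the direct cost and the split
      inequality. The correction of \<open>A i * B i\<close> accounts for the pivot and for the
      diagonal of the product.\<close>
    have part: "?E (?part i)
        (\<lambda>z. ?E (quicksort_impl (fst (fst z))) (\<lambda>y. ?E (quicksort_impl (snd (fst z)))
          (\<lambda>z'. real (cost i z y z')))) \<le>
        quicksort_bound n + 7 * real n - 37 + 21 / n - 42 / n * (A i * B i - 3 / 4 * n + 1 / 2)"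
      (is "?lhs \<le> _") if i: "i < n" for i
    proof -
      have i': "i < length xs" using i by (simp add: n_def)
      have "?lhs \<le> ?E (?part i) (\<lambda>z. (quicksort_bound n + 7 * real n - 37 + 21 / n)
          - 42 / n * (real (length (fst (fst z))) * real (length (snd (fst z)))))"
      proof (rule expectation_mono[OF fin(1)])
        fix z assume z: "z \<in> set_pmf (?part i)"
        obtain ls rs c where [simp]: "z = ((ls, rs), c)" by (metis prod.exhaust)
        have len: "length ls + length rs + 1 = n"
          using length_partition_impl[of ls rs c] z i by (simp add: n_def)
        have c: "c = n" using partition_impl_cost[OF z] i by (simp add: n_def)
        have "?E (quicksort_impl ls) (\<lambda>y. ?E (quicksort_impl rs) (\<lambda>z'. real (cost i z y z'))) \<le>
          ?E (quicksort_impl ls) (\<lambda>y. ?E (quicksort_impl rs) (\<lambda>z'. 7 * real n + 3 + real (snd y) + real (snd z')))"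
        proof (intro expectation_mono fin)
          fix y z' assume "y \<in> set_pmf (quicksort_impl ls)"
          then have "length (fst y) < n" using length_quicksort_impl[of y ls] len by simp
          \<comment> \<open>Length, partition and final append contribute about 3 n, the four list
            operations that go up to the pivot about 4 i; exactly, the sum is at most 3 n + 4 i + 7
            with i \<le> n - 1.\<close>
          then have "cost i z y z' \<le> 7 * n + 3 + snd y + snd z'"
            using i c by (simp add: cost_def T_length T_nth T_take T_drop T_append n_def)
          then show "real (cost i z y z') \<le> 7 * real n + 3 + real (snd y) + real (snd z')" by linarith
        qed
        also have "\<dots> = 7 * real n + 3 + ?E (quicksort_impl ls) (\<lambda>y. real (snd y))
            + ?E (quicksort_impl rs) (\<lambda>y. real (snd y))"
          by (simp add: int)
        also have "\<dots> \<le> 7 * real n + 3 + quicksort_bound (length ls) + quicksort_bound (length rs)"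
          using len 1 by (intro add_mono) (auto simp: n_def)
        also have "\<dots> \<le> 7 * real n + 3 + (quicksort_bound n
            - 21 * (2 * (real (length ls) * real (length rs)) + real n - 1) / real n - 19)"
          using quicksort_bound_split[OF len] by simp
        also have "\<dots> = (quicksort_bound n + 7 * real n - 37 + 21 / n)
          - 42 / n * (real (length ls) * real (length rs))"
          using n by (simp add: field_simps)
        finally show "?E (quicksort_impl (fst (fst z))) (\<lambda>y. ?E (quicksort_impl (snd (fst z)))
            (\<lambda>z'. real (cost i z y z'))) \<le> (quicksort_bound n + 7 * real n - 37 + 21 / n)
          - 42 / n * (real (length (fst (fst z))) * real (length (snd (fst z))))" by simp
      qed
      \<comment> \<open>\<open>A\<close> and \<open>B\<close> include the pivot itself, with
        preference 1/2, whereas the partitioned list omits it; hence the subtracted 1/2 and, on the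
        diagonal, 1/4.\<close>
      also have "\<dots> = (quicksort_bound n + 7 * real n - 37 + 21 / n)
          - 42 / n * ((A i - 1 / 2) * (B i - 1 / 2) - ((\<Sum>j<n. q j i * q i j) - 1 / 4))"
        by (simp add: int expectation_partition_impl sum_list_remove_nth[OF i'] q(3)
            q_def[symmetric] A_def B_def n_def del: map_append sum_list_append)
      also have "\<dots> \<le> (quicksort_bound n + 7 * real n - 37 + 21 / n)
          - 42 / n * (A i * B i - 3 / 4 * n + 1 / 2)"
      proof -
        have "A i + B i = (\<Sum>j<n. 1)"
          unfolding A_def B_def sum.distrib[symmetric] by (intro sum.cong) (auto simp: q(1)[of i])
        then have AB: "A i + B i = n" by simp
        have "(\<Sum>j<n. q j i * q i j) \<le> (\<Sum>j<n. 1 / 4)"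
        proof (intro sum_mono)
          fix j
          have "0 \<le> (q i j - 1 / 2)\<^sup>2" by simp
          then show "q j i * q i j \<le> 1 / 4"
            unfolding q(1)[of j i] by (simp add: power2_eq_square algebra_simps)
        qed
        then have "(\<Sum>j<n. q j i * q i j) \<le> n / 4" by simp
        then have "A i * B i - 3 / 4 * n + 1 / 2 \<le> (A i - 1 / 2) * (B i - 1 / 2) - ((\<Sum>j<n. q j i * q i j) - 1 / 4)"
          using AB by (simp add: algebra_simps)
        then show ?thesis using n by (intro diff_left_mono mult_left_mono) auto
      qed
      finally show ?thesis .
    qed
    have "?E (quicksort_impl xs) (\<lambda>z. real (snd z)) \<le> ?E (pmf_of_set {..<n})
        (\<lambda>i. quicksort_bound n + 7 * real n - 37 + 21 / n - 42 / n * (A i * B i - 3 / 4 * n + 1 / 2))"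
      unfolding E using n part by (intro expectation_mono) (auto simp: lessThan_empty_iff)
    also have "\<dots> = quicksort_bound n + 7 * real n - 37 + 21 / n
        - 42 / n * ((\<Sum>i<n. A i * B i) / n - 3 / 4 * n + 1 / 2)"
    proof -
      have "(\<Sum>i<n. K - a * (A i * B i - b + 1 / 2)) = n * K - a * ((\<Sum>i<n. A i * B i) - n * b + n * (1 / 2))"
        for K a b :: real
        by (simp add: sum_subtractf sum.distrib flip: sum_distrib_left)
      then have K: "(\<Sum>i<n. K - a * (A i * B i - b + 1 / 2)) / n = K - a * ((\<Sum>i<n. A i * B i) / n - b + 1 / 2)"
        for K a b :: real
        using n by (simp add: field_simps)
      have E_unif: "?E (pmf_of_set {..<n}) g = (\<Sum>i<n. g i) / n" for g :: "nat \<Rightarrow> real"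
        using n by (subst integral_pmf_of_set) (auto simp: lessThan_empty_iff)
      show ?thesis unfolding E_unif by (rule K)
    qed
    also have "\<dots> \<le> quicksort_bound n + 7 * real n - 37 + 21 / n
        - 42 / n * (real n ^ 3 / 6 / n - 3 / 4 * n + 1 / 2)"
    proof -
      have "real n ^ 3 / 6 \<le> (\<Sum>i<n. A i * B i)"
        using sum_paths_ge[OF finite_lessThan q(2) q(1), of n] by (simp add: A_def B_def)
      then have "real n ^ 3 / 6 / n \<le> (\<Sum>i<n. A i * B i) / n" by (rule divide_right_mono) simp
      then show ?thesis using n by (intro diff_left_mono mult_left_mono) auto
    qed
    \<comment> \<open>The terms 7 n and 21 / n cancel, leaving -37 + 42 * 3 / 4.\<close>
    also have "\<dots> = quicksort_bound n - 11 / 2"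
      using n by (simp add: field_simps power3_eq_cube)
    finally show ?thesis by (simp add: n_def)
  qed
qed

section \<open>Plackett-Luce implementation\<close>

text \<open>The weight share of an item factors into the share of its side and its share within that
  side. This is what one coin at an inner node implements.\<close>

lemma proportional_pmf_Un:
  assumes "finite A" "finite B" "A \<noteq> {}" "B \<noteq> {}" "A \<inter> B = {}" "\<And>u. f u > 0"
  shows "proportional_pmf (A \<union> B) f =
    bernoulli_pmf (sum f A / (sum f A + sum f B)) \<bind>
      (\<lambda>left. if left then proportional_pmf A f else proportional_pmf B f)"
proof (rule pmf_eqI)
  fix u
  have pos: "sum f A > 0" "sum f B > 0" using assms by (auto intro!: sum_pos)
  have ne: "sum f A \<noteq> 0" "sum f B \<noteq> 0" "sum f A + sum f B \<noteq> 0" using pos by linarith+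
  have p: "0 \<le> sum f A / (sum f A + sum f B)" "sum f A / (sum f A + sum f B) \<le> 1"
    using pos by (simp_all add: divide_simps)
  have [simp]: "1 - sum f A / (sum f A + sum f B) = sum f B / (sum f A + sum f B)"
    using ne by (simp add: field_simps)
  show "pmf (proportional_pmf (A \<union> B) f) u = pmf (bernoulli_pmf (sum f A / (sum f A + sum f B)) \<bind>
      (\<lambda>left. if left then proportional_pmf A f else proportional_pmf B f)) u"
    unfolding pmf_bind integral_bernoulli_pmf[OF p]
    using assms ne by (auto simp: pmf_proportional_pmf sum.union_disjoint)
qed

primrec valid_sums :: "('a \<Rightarrow> real) \<Rightarrow> 'a sum_tree \<Rightarrow> bool" where
  "valid_sums f Tip = True"
| "valid_sums f (Leaf a x) = (x = f a)"
| "valid_sums f (Node l x r) = (valid_sums f l \<and> valid_sums f r \<and> x = total l + total r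
     \<and> set_sum_tree l \<inter> set_sum_tree r = {})"

text \<open>Describes the tree left by \<open>draw\<close> as a function of the drawn item alone;
  the sums on the path are recomputed by \<open>node\<close>.\<close>

primrec remove_leaf :: "'a \<Rightarrow> 'a sum_tree \<Rightarrow> 'a sum_tree" where
  "remove_leaf a Tip = Tip"
| "remove_leaf a (Leaf b x) = (if a = b then Tip else Leaf b x)"
| "remove_leaf a (Node l x r) =
     (if a \<in> set_sum_tree l then node (remove_leaf a l) r else node l (remove_leaf a r))"

lemma finite_set_sum_tree [simp]: "finite (set_sum_tree t)"
  by (induction t) auto

lemma total_eq_sum: "valid_sums f t \<Longrightarrow> total t = sum f (set_sum_tree t)"
  by (induction t) (auto simp: sum.union_disjoint)

lemma set_remove_leaf:
  "valid_sums f t \<Longrightarrow> set_sum_tree (remove_leaf a t) = set_sum_tree t - {a}"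
  by (induction t) (auto simp: node_def)

lemma valid_remove_leaf: "valid_sums f t \<Longrightarrow> valid_sums f (remove_leaf a t)"
  by (induction t) (auto simp: node_def set_remove_leaf)

lemma bernoulli_pmf_0: "bernoulli_pmf 0 = return_pmf False"
proof (rule pmf_eqI)
  show "pmf (bernoulli_pmf 0) b = pmf (return_pmf False) b" for b by (cases b) simp_all
qed

lemma bernoulli_pmf_1: "bernoulli_pmf 1 = return_pmf True"
proof (rule pmf_eqI)
  show "pmf (bernoulli_pmf 1) b = pmf (return_pmf True) b" for b by (cases b) simp_all
qed

lemma draw_outcome:
  assumes "\<And>a. f a > 0" "valid_sums f t" "set_sum_tree t \<noteq> {}"
  shows "map_pmf fst (draw t) = map_pmf (\<lambda>a. (a, remove_leaf a t)) (proportional_pmf (set_sum_tree t) f)"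
  using assms(2,3)
proof (induction t)
  case (Leaf a x)
  have "set_pmf (proportional_pmf {a} f) = {a}" using assms(1) by (simp add: set_proportional_pmf)
  then have "proportional_pmf {a} f = return_pmf a" by (simp add: set_pmf_subset_singleton[symmetric])
  then show ?case by simp
next
  case (Node l x r)
  let ?A = "set_sum_tree l" and ?B = "set_sum_tree r" and ?t = "Node l x r"
  have valid: "valid_sums f l" "valid_sums f r" and x: "x = sum f ?A + sum f ?B"
    and disj: "?A \<inter> ?B = {}"
    using Node.prems total_eq_sum[of f l] total_eq_sum[of f r] by simp_all
  have pos: "sum f S > 0" if "finite S" "S \<noteq> {}" for S using that assms(1) by (auto intro: sum_pos)
  have left: "map_pmf (\<lambda>z. (fst z, node (snd z) r)) (map_pmf fst (draw l)) =
    map_pmf (\<lambda>a. (a, remove_leaf a ?t)) (proportional_pmf ?A f)" if "?A \<noteq> {}"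
    unfolding Node.IH(1)[OF valid(1) that] pmf.map_comp o_def
    using that assms(1) by (intro map_pmf_cong refl) (simp add: set_proportional_pmf)
  have right: "map_pmf (\<lambda>z. (fst z, node l (snd z))) (map_pmf fst (draw r)) =
    map_pmf (\<lambda>a. (a, remove_leaf a ?t)) (proportional_pmf ?B f)" if "?B \<noteq> {}"
    unfolding Node.IH(2)[OF valid(2) that] pmf.map_comp o_def
    using that assms(1) disj by (intro map_pmf_cong refl) (auto simp: set_proportional_pmf)
  have draw: "map_pmf fst (draw ?t) = bernoulli_pmf (sum f ?A / x) \<bind>
    (\<lambda>b. if b then map_pmf (\<lambda>z. (fst z, node (snd z) r)) (map_pmf fst (draw l))
          else map_pmf (\<lambda>z. (fst z, node l (snd z))) (map_pmf fst (draw r)))"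
    by (auto simp: map_bind_pmf total_eq_sum[OF valid(1)] map_pmf_def[symmetric] pmf.map_comp o_def
        case_prod_unfold intro!: bind_pmf_cong)
  \<comment> \<open>Proportional choice is meaningful on nonempty sets only. At a node with one
    exhausted side the coin has bias 0 or 1, so the draw never enters that side.\<close>
  consider "?A = {}" "?B \<noteq> {}" | "?A \<noteq> {}" "?B = {}" | "?A \<noteq> {}" "?B \<noteq> {}"
    using Node.prems by auto
  then show ?case
  proof cases
    case 1
    then show ?thesis unfolding draw using right by (simp add: bind_return_pmf bernoulli_pmf_0)
  next
    case 2
    then show ?thesis unfolding draw using left pos[of ?A] by (simp add: bind_return_pmf bernoulli_pmf_1 x)
  next
    case 3
    have Un: "proportional_pmf (?A \<union> ?B) f =
      bernoulli_pmf (sum f ?A / x) \<bind> (\<lambda>b. if b then proportional_pmf ?A f else proportional_pmf ?B f)"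
      unfolding x using 3 assms(1) disj by (intro proportional_pmf_Un) auto
    have "map_pmf (\<lambda>a. (a, remove_leaf a ?t)) (proportional_pmf (?A \<union> ?B) f) =
      bernoulli_pmf (sum f ?A / x) \<bind> (\<lambda>b. if b then map_pmf (\<lambda>a. (a, remove_leaf a ?t)) (proportional_pmf ?A f)
          else map_pmf (\<lambda>a. (a, remove_leaf a ?t)) (proportional_pmf ?B f))"
      unfolding Un map_bind_pmf by (intro bind_pmf_cong refl) (simp del: remove_leaf.simps)
    then show ?thesis unfolding draw left[OF 3(1)] right[OF 3(2)] by simp
  qed
qed simp

lemma draws_outcome:
  assumes "valid_sums (\<lambda>a. exp (w a)) t" "card (set_sum_tree t) = k"
  shows "map_pmf fst (draws k t) = plackett_luce_steps w k (set_sum_tree t)"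
  using assms
proof (induction k arbitrary: t)
  case (Suc k)
  let ?p = "proportional_pmf (set_sum_tree t) (\<lambda>a. exp (w a))"
  have ne: "set_sum_tree t \<noteq> {}" using Suc.prems by auto
  have "map_pmf fst (draws (Suc k) t) = map_pmf fst (draw t) \<bind>
      (\<lambda>z. map_pmf fst (draws k (snd z)) \<bind> (\<lambda>xs. return_pmf (fst z # xs)))"
    by (simp add: map_bind_pmf bind_map_pmf case_prod_unfold)
  also have "\<dots> = ?p \<bind> (\<lambda>a. map_pmf fst (draws k (remove_leaf a t)) \<bind> (\<lambda>xs. return_pmf (a # xs)))"
    by (simp add: draw_outcome[OF _ Suc.prems(1) ne] bind_map_pmf)
  also have "\<dots> = ?p \<bind> (\<lambda>a. plackett_luce_steps w k (set_sum_tree t - {a}) \<bind> (\<lambda>xs. return_pmf (a # xs)))"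
  proof (intro bind_pmf_cong refl)
    fix a assume "a \<in> set_pmf ?p"
    then have "a \<in> set_sum_tree t" using ne by (simp add: set_proportional_pmf)
    then show "map_pmf fst (draws k (remove_leaf a t)) = plackett_luce_steps w k (set_sum_tree t - {a})"
      using Suc.IH[of "remove_leaf a t"] Suc.prems
      by (simp add: valid_remove_leaf set_remove_leaf[OF Suc.prems(1)])
  qed
  finally show ?case by simp
qed simp

section \<open>Number of steps of the sum-tree implementation\<close>

primrec sum_tree_height :: "'a sum_tree \<Rightarrow> nat" where
  "sum_tree_height Tip = 1"
| "sum_tree_height (Leaf a x) = 1"
| "sum_tree_height (Node l x r) = 1 + max (sum_tree_height l) (sum_tree_height r)"

text \<open>A draw visits one node per level. Since \<open>Tip\<close> counts as high as
  \<open>Leaf\<close>, removal does not increase the height, and one bound serves all later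
  draws.\<close>

lemma draw_cost:
  "z \<in> set_pmf (draw t) \<Longrightarrow> snd z \<le> sum_tree_height t \<and> sum_tree_height (snd (fst z)) \<le> sum_tree_height t"
proof (induction t arbitrary: z)
  case (Node l x r)
  from Node.prems consider y where "y \<in> set_pmf (draw l)" "z = ((fst (fst y), node (snd (fst y)) r), snd y + 1)"
    | y where "y \<in> set_pmf (draw r)" "z = ((fst (fst y), node l (snd (fst y))), snd y + 1)"
    by (auto simp: case_prod_unfold split: if_splits)
  then show ?case using Node.IH by cases (fastforce simp: node_def)+
qed auto

lemma draws_cost:
  "sum_tree_height t \<le> h \<Longrightarrow> z \<in> set_pmf (draws k t) \<Longrightarrow> snd z \<le> k * (h + 1) + 1"
proof (induction k arbitrary: t z)
  case (Suc k)
  from Suc.prems(2) obtain y z' where *: "y \<in> set_pmf (draw t)" "z' \<in> set_pmf (draws k (snd (fst y)))"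
    "snd z = snd y + snd z' + 1"
    by (auto simp: case_prod_unfold)
  show ?case using draw_cost[OF *(1)] Suc.IH[OF _ *(2)] Suc.prems(1) *(3) by simp
qed simp

lemma build_rec:
  assumes "n > 1"
  shows "build n xs = (let m = n div 2; z = build m xs; z' = build (n - m) (snd z)
    in (node (fst z) (fst z'), snd z'))"
  using assms by (subst build.simps) (simp add: Let_def case_prod_unfold)

lemma build_1: "build (Suc 0) xs = (Leaf (fst (hd xs)) (snd (hd xs)), tl xs)"
  and build_0: "build 0 xs = (Tip, xs)"
  by (simp_all add: build.simps)

text \<open>The right subtree is built from the list that the left one returns, so the remainder
  belongs to the induction claim.\<close>

lemma build_correct:
  assumes "n \<le> length xs" "distinct (map fst xs)" "\<And>a x. (a, x) \<in> set xs \<Longrightarrow> x = f a"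
  shows "snd (build n xs) = drop n xs \<and> valid_sums f (fst (build n xs)) \<and>
    set_sum_tree (fst (build n xs)) = fst ` set (take n xs)"
  using assms
proof (induction n arbitrary: xs rule: less_induct)
  case (less n)
  consider "n = 0" | "n = 1" | "n > 1" by linarith
  then show ?case
  proof cases
    case 1
    then show ?thesis by (simp add: build_0)
  next
    case 2
    then obtain b ys where "xs = b # ys" using less.prems(1) by (cases xs) auto
    then show ?thesis using 2 less.prems(3)[of "fst b" "snd b"] by (simp add: build_1)
  next
    case 3
    define m where "m = n div 2"
    have m: "m < n" "n - m < n" using 3 by (auto simp: m_def)
    have l: "snd (build m xs) = drop m xs" "valid_sums f (fst (build m xs))"
      "set_sum_tree (fst (build m xs)) = fst ` set (take m xs)"
      using less.IH[OF m(1), of xs] less.prems m by auto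
    have r: "snd (build (n - m) (drop m xs)) = drop n xs" "valid_sums f (fst (build (n - m) (drop m xs)))"
      "set_sum_tree (fst (build (n - m) (drop m xs))) = fst ` set (take (n - m) (drop m xs))"
    proof -
      have "snd (build (n - m) (drop m xs)) = drop (n - m) (drop m xs) \<and>
        valid_sums f (fst (build (n - m) (drop m xs))) \<and>
        set_sum_tree (fst (build (n - m) (drop m xs))) = fst ` set (take (n - m) (drop m xs))"
      proof (rule less.IH[OF m(2)])
        show "distinct (map fst (drop m xs))" using less.prems(2) by (simp add: drop_map[symmetric])
      qed (use less.prems(1,3) in_set_dropD in fastforce)+
      then show "snd (build (n - m) (drop m xs)) = drop n xs" "valid_sums f (fst (build (n - m) (drop m xs)))"
        "set_sum_tree (fst (build (n - m) (drop m xs))) = fst ` set (take (n - m) (drop m xs))"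
        using m by simp_all
    qed
    have split: "take n xs = take m xs @ take (n - m) (drop m xs)"
      using m by (simp flip: take_add)
    have "distinct (map fst (take n xs))"
      using less.prems(2) by (simp add: take_map[symmetric])
    then have "fst ` set (take m xs) \<inter> fst ` set (take (n - m) (drop m xs)) = {}"
      unfolding split by simp
    then show ?thesis
      unfolding build_rec[OF 3] m_def[symmetric] using l r
      by (simp add: Let_def node_def split image_Un)
  qed
qed

lemma T_build_le: "T_build n xs \<le> 2 * n + 1"
proof -
  \<comment> \<open>The sharper 2 n - 1, the number of nodes of a binary tree with n leaves, is
    inductive: (2 m - 1) + (2 (n - m) - 1) + 1 = 2 n - 1.\<close>
  have "T_build n xs \<le> (if n = 0 then 1 else 2 * n - 1)"
  proof (induction n arbitrary: xs rule: less_induct)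
    case (less n)
    show ?case
    proof (cases "n \<le> 1")
      case False
      define m where "m = n div 2"
      have m: "m < n" "n - m < n" "m \<noteq> 0" "n - m \<noteq> 0" using False by (auto simp: m_def)
      show ?thesis
        using less.IH[OF m(1), of xs] less.IH[OF m(2), of "snd (build m xs)"] False m
        by (subst T_build.simps) (simp add: m_def[symmetric])
    qed (auto simp: T_build.simps le_Suc_eq)
  qed
  then show ?thesis by (rule le_trans) auto
qed

text \<open>Bounding \<open>n\<close> by a power of two avoids roundings of logarithms: both halves,
  also the one rounded up, stay below the next smaller power.\<close>

lemma height_build: "n \<le> 2 ^ k \<Longrightarrow> sum_tree_height (fst (build n xs)) \<le> k + 1"
proof (induction n arbitrary: xs k rule: less_induct)
  case (less n)
  consider "n = 0" | "n = 1" | "n > 1" by linarith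
  then show ?case
  proof cases
    case 3
    define m where "m = n div 2"
    have m: "m < n" "n - m < n" using 3 by (auto simp: m_def)
    obtain j where k: "k = Suc j" using less.prems 3 by (cases k) auto
    have "m \<le> 2 ^ j" "n - m \<le> 2 ^ j" using less.prems by (auto simp: m_def k)
    then show ?thesis
      unfolding build_rec[OF 3] m_def[symmetric]
      using less.IH[OF m(1)] less.IH[OF m(2)] by (simp add: Let_def node_def k)
  qed (simp_all add: build_0 build_1)
qed

lemma plackett_luce_impl_outcome:
  assumes "distinct vs"
  shows "map_pmf fst (plackett_luce_impl (map (\<lambda>v. (v, w v)) vs)) = plackett_luce w (set vs)"
proof -
  let ?ws = "map (\<lambda>v. (v, exp (w v))) vs"
  have "snd (build (length vs) ?ws) = drop (length vs) ?ws \<and>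
      valid_sums (\<lambda>a. exp (w a)) (fst (build (length vs) ?ws)) \<and>
      set_sum_tree (fst (build (length vs) ?ws)) = fst ` set (take (length vs) ?ws)"
    by (rule build_correct) (use assms in \<open>auto simp: o_def\<close>)
  then have "valid_sums (\<lambda>a. exp (w a)) (fst (build (length vs) ?ws))"
    "set_sum_tree (fst (build (length vs) ?ws)) = set vs"
    by (simp_all add: image_image)
  then show ?thesis
    using assms draws_outcome[of w "fst (build (length vs) ?ws)" "length vs"]
    by (simp add: plackett_luce_impl_def plackett_luce_def Let_def o_def pmf.map_comp distinct_card)
qed

lemma plackett_luce_impl_cost:
  assumes "z \<in> set_pmf (plackett_luce_impl ws)" and n: "n = length ws"
  shows "real (snd z) \<le> 2 * (real n * ln (real n)) + 8 * real n + 5"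
proof -
  define xs where "xs = map (map_prod id exp) ws"
  from assms(1) obtain z' where z': "z' \<in> set_pmf (draws n (fst (build n xs)))"
    "snd z = T_length ws + T_map (\<lambda>_. 1) ws + T_build n xs + snd z' + 1"
    by (auto simp: plackett_luce_impl_def Let_def xs_def n)
  define k where "k = nat \<lceil>log 2 (real n)\<rceil>"
  have "real n \<le> 2 ^ k"
  proof (cases "n = 0")
    case False
    then have "real n = 2 powr log 2 (real n)" by simp
    also have "\<dots> \<le> 2 powr real k"
      by (intro powr_mono) (auto simp: k_def real_nat_ceiling_ge)
    finally show ?thesis by (simp add: powr_realpow)
  qed simp
  then have "n \<le> 2 ^ k" by (simp add: of_nat_le_iff[symmetric] del: of_nat_le_iff)
  then have "snd z' \<le> n * (k + 2) + 1"
    using draws_cost[OF height_build z'(1)] by simp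
  then have "snd z \<le> 7 * n + 5 + n * k"
    using z'(2) T_build_le[of n xs] by (simp add: T_length T_map n sum_list_triv algebra_simps)
  then have "real (snd z) \<le> real (7 * n + 5 + n * k)" by (rule of_nat_mono)
  then have "real (snd z) \<le> 7 * real n + 5 + real n * real k" by simp
  also have "real n * real k \<le> real n * (2 * ln (real n) + 1)"
  proof (cases "n = 0")
    case False
    then have "0 \<le> log 2 (real n)" by simp
    then have "real k \<le> log 2 (real n) + 1" unfolding k_def by linarith
    \<comment> \<open>The factor 2 exceeds 1 / ln 2, since ln 2 \<ge> 1/2.\<close>
    also have "log 2 (real n) \<le> 2 * ln (real n)"
    proof -
      have "1 \<le> 2 * ln (2 :: real)" using ln2_ge_two_thirds by simp
      then have "ln (real n) * 1 \<le> ln (real n) * (2 * ln 2)" using False by (intro mult_left_mono) auto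
      then show ?thesis by (simp add: log_def divide_simps mult_ac)
    qed
    finally show ?thesis by (intro mult_left_mono) auto
  qed simp
  finally show ?thesis by (simp add: algebra_simps)
qed

section \<open>One step and the theorem\<close>

text \<open>The new weights depend on the feedback and not on the ranking drawn, so the joint law is
  that of the ranking paired with a constant, which is the input of the next step.\<close>

lemma step_impl_outcome:
  assumes "distinct vs" "t \<ge> 1"
  shows "map_pmf fst (step_impl sp \<eta> (s t) (stored \<eta> s vs (t - 1))) =
    map_pmf (\<lambda>xs. (xs, stored \<eta> s vs t)) (sort_pmf sp (weight \<eta> s (t - 1)) (set vs))"
proof -
  have sort: "map_pmf fst (sort_impl sp (stored \<eta> s vs (t - 1))) = sort_pmf sp (weight \<eta> s (t - 1)) (set vs)"
    unfolding stored_def using assms(1)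
    by (cases sp) (simp_all add: quicksort_impl_outcome plackett_luce_impl_outcome)
  have "stored \<eta> s vs t = map (\<lambda>(v, x). (v, x + \<eta> * s t v)) (stored \<eta> s vs (t - 1))"
    using assms(2) by (cases t) (auto simp: stored_def)
  then show ?thesis
    unfolding sort[symmetric] pmf.map_comp step_impl_def
    by (simp add: map_pmf_def bind_assoc_pmf bind_return_pmf case_prod_unfold o_def)
qed

lemma finite_set_plackett_luce_impl: "finite (set_pmf (plackett_luce_impl ws))"
proof -
  have draw: "finite (set_pmf (draw t))" for t :: "'a sum_tree"
    by (induction t) (auto simp: finite_set_pmf_bool case_prod_unfold)
  have "finite (set_pmf (draws k t))" for k and t :: "'a sum_tree"
    by (induction k arbitrary: t) (auto simp: draw case_prod_unfold)
  then show ?thesis by (simp add: plackett_luce_impl_def Let_def)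
qed

lemma step_impl_eq:
  "step_impl sp \<eta> s ws = map_pmf (\<lambda>z. ((fst z, map (\<lambda>(v, x). (v, x + \<eta> * s v)) ws), snd z + 2 * length ws + 2))
     (sort_impl sp ws)"
  by (simp add: step_impl_def map_pmf_def case_prod_unfold T_map sum_list_triv mult_2)

text \<open>A common bound for both procedures, with 2 n + 2 added for the weight update: the
  coefficients 21 and 22 = 20 + 2 come from QuickSort, the constant 7 = 5 + 2 from
  Plackett-Luce.\<close>

definition step_bound :: "nat \<Rightarrow> real" where
  "step_bound n = 21 * (real n * ln (real n)) + 22 * real n + 7"

lemma step_bound_bigo: "step_bound \<in> O(\<lambda>n. real n * ln (real n))"
\<comment> \<open>50 = 21 + 22 + 7, and ln n \<ge> 1 from n = 3 on because e \<le> 3.\<close>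
proof (rule bigoI[where c = 50], rule eventually_at_top_linorderI[of 3])
  fix n :: nat assume n: "n \<ge> 3"
  have "1 \<le> ln (real n)" using n exp_le by (subst ln_ge_iff) auto
  then have ge: "real n * 1 \<le> real n * ln (real n)" by (intro mult_left_mono) auto
  show "norm (step_bound n) \<le> 50 * norm (real n * ln (real n))"
  proof -
    have "step_bound n \<le> 50 * (real n * ln (real n))" "0 \<le> step_bound n"
      using ge of_nat_mono[OF n, where 'a = real] unfolding step_bound_def by linarith+
    then show ?thesis by simp
  qed
qed

lemma step_cost_plackett_luce:
  assumes "z \<in> set_pmf (step_impl PlackettLuce \<eta> s ws)"
  shows "real (snd z) \<le> step_bound (length ws)"
proof -
  obtain y where y: "y \<in> set_pmf (plackett_luce_impl ws)" "snd z = snd y + 2 * length ws + 2"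
    using assms by (auto simp: step_impl_eq)
  have "0 \<le> real (length ws) * ln (real (length ws))" by (cases ws) auto
  then show ?thesis
    using plackett_luce_impl_cost[OF y(1) refl] y(2) by (simp add: step_bound_def)
qed

lemma expectation_step_cost:
  "measure_pmf.expectation (step_impl sp \<eta> s ws) (\<lambda>z. real (snd z)) \<le> step_bound (length ws)"
proof (cases sp)
  case QuickSort
  have "integrable (measure_pmf (quicksort_impl ws)) (\<lambda>z. real (snd z))"
    by (intro integrable_measure_pmf_finite finite_set_quicksort_impl)
  then show ?thesis
    using expectation_quicksort_impl[of ws]
    by (simp add: QuickSort step_impl_eq step_bound_def quicksort_bound_def)
next
  case PlackettLuce
  have fin: "finite (set_pmf (step_impl PlackettLuce \<eta> s ws))"
    by (simp add: step_impl_eq finite_set_plackett_luce_impl)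
  have "measure_pmf.expectation (step_impl PlackettLuce \<eta> s ws) (\<lambda>z. real (snd z)) \<le>
      measure_pmf.expectation (step_impl PlackettLuce \<eta> s ws) (\<lambda>_. step_bound (length ws))"
    by (rule expectation_mono[OF fin step_cost_plackett_luce])
  then show ?thesis by (simp add: PlackettLuce)
qed

text \<open>The time bound \<open>f\<close> is chosen before the items, the feedback and all
  parameters, so the constant hidden in the O is uniform in them.\<close>

theorem theorem3p1:
  "\<exists>f :: nat \<Rightarrow> real. f \<in> O(\<lambda>n. real n * ln (real n)) \<and>
    (\<forall>(V :: 'a set) (n :: nat) (T :: nat) (s :: nat \<Rightarrow> 'a \<Rightarrow> real) (M :: real) (\<eta> :: real).
       finite V \<longrightarrow> n = card V \<longrightarrow>
       (\<forall>t\<in>{1..T}. \<forall>v\<in>V. s t v \<in> {0, 1}) \<longrightarrow>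
       M > 0 \<longrightarrow> (\<forall>t\<in>{1..T}. pair_variation V (s t) \<le> M) \<longrightarrow>
       real T \<ge> (real n)\<^sup>2 / M * ln 2 \<longrightarrow>
       \<eta> = real n * sqrt (ln 2) / sqrt (real T * M) \<longrightarrow>
       \<eta> \<le> 1 \<and>
       (\<forall>sp :: sort_proc.
          (\<forall>\<pi>\<^sub>o\<^sub>p\<^sub>t. is_arg_min (\<lambda>\<pi>. total_loss V s T (\<lambda>_. \<pi>)) (\<lambda>\<pi>. \<pi> \<in> rankings V) \<pi>\<^sub>o\<^sub>p\<^sub>t \<longrightarrow>
             measure_pmf.expectation (online_rank sp V \<eta> s T) (total_loss V s T)
               \<le> total_loss V s T (\<lambda>_. \<pi>\<^sub>o\<^sub>p\<^sub>t) + real n * sqrt (real T * M * ln 2)) \<and>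
          (\<forall>vs. distinct vs \<longrightarrow> set vs = V \<longrightarrow> (\<forall>t\<in>{1..T}.
             let step = step_impl sp \<eta> (s t) (stored \<eta> s vs (t - 1)) in
               map_pmf fst step
                 = map_pmf (\<lambda>xs. (xs, stored \<eta> s vs t)) (sort_pmf sp (weight \<eta> s (t - 1)) V) \<and>
               measure_pmf.expectation step (\<lambda>(_, c). real c) \<le> f n \<and>
               (sp = PlackettLuce \<longrightarrow> (\<forall>(_, c)\<in>set_pmf step. real c \<le> f n))))))"
proof (intro exI[of _ step_bound] conjI step_bound_bigo allI impI ballI)
  fix V :: "'a set" and n T :: nat and s :: "nat \<Rightarrow> 'a \<Rightarrow> real" and M \<eta> :: real
  assume V: "finite V" "n = card V" and M: "M > 0"
    and var: "\<forall>t\<in>{1..T}. pair_variation V (s t) \<le> M"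
    and T: "real T \<ge> (real n)\<^sup>2 / M * ln 2"
    and \<eta>: "\<eta> = real n * sqrt (ln 2) / sqrt (real T * M)"
  show "\<eta> \<le> 1" unfolding \<eta> by (rule learning_rate_le_1[OF M T])
  fix sp
  {
    fix \<pi> assume "is_arg_min (\<lambda>\<pi>. total_loss V s T (\<lambda>_. \<pi>)) (\<lambda>\<pi>. \<pi> \<in> rankings V) \<pi>"
    then have "inj_on \<pi> V" by (simp add: is_arg_min_def rankings_def)
    then show "measure_pmf.expectation (online_rank sp V \<eta> s T) (total_loss V s T)
      \<le> total_loss V s T (\<lambda>_. \<pi>) + real n * sqrt (real T * M * ln 2)"
      using var by (intro regret_bound_tuned[OF V _ M _ T \<eta>]) auto
  }
  fix vs t assume vs: "distinct vs" "set vs = V" and t: "t \<in> {1..T}"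
  let ?step = "step_impl sp \<eta> (s t) (stored \<eta> s vs (t - 1))"
  have len: "length (stored \<eta> s vs (t - 1)) = n"
    using vs V(2) distinct_card[OF vs(1)] by (simp add: stored_def)
  have "map_pmf fst ?step =
      map_pmf (\<lambda>xs. (xs, stored \<eta> s vs t)) (sort_pmf sp (weight \<eta> s (t - 1)) V)"
    using step_impl_outcome[OF vs(1)] t vs(2) by simp
  moreover have "measure_pmf.expectation ?step (\<lambda>(_, c). real c) \<le> step_bound n"
    using expectation_step_cost[of sp \<eta> "s t" "stored \<eta> s vs (t - 1)"]
    unfolding len case_prod_unfold .
  moreover have "\<forall>(_, c)\<in>set_pmf ?step. real c \<le> step_bound n" if "sp = PlackettLuce"
    using step_cost_plackett_luce[of _ \<eta> "s t" "stored \<eta> s vs (t - 1)"] that len by fastforce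
  ultimately show "let step = ?step in
     map_pmf fst step = map_pmf (\<lambda>xs. (xs, stored \<eta> s vs t)) (sort_pmf sp (weight \<eta> s (t - 1)) V) \<and>
     measure_pmf.expectation step (\<lambda>(_, c). real c) \<le> step_bound n \<and>
     (sp = PlackettLuce \<longrightarrow> (\<forall>(_, c)\<in>set_pmf step. real c \<le> step_bound n))"
    by (simp add: Let_def)
qed

end
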